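(* Let $(\mathcal H,D)$ be an unbounded Fredholm module over a unital $C^*$-algebra $\mathcal A$, with $\mathcal B=\{a\in\mathcal A:[D,a]\text{ is densely defined and extends to a bounded operator on }\mathcal H\}$. Let the matrix metric $\mathcal{D_L}=(D_{L_n})$ on the matrix state space $\mathcal{CS}(\mathcal A)=(CS_n(\mathcal A))$ be defined by $$D_{L_n}(\varphi,\psi)=\sup\{\|\ll\varphi,a\gg-\ll\psi,a\gg\|: a=[a_{ij}]\in M_r(\mathcal B),\ L_r(a)=\|[[D,a_{ij}]]\|\le 1,\ r\in\mathbb N\}$$ for $\varphi,\psi\in CS_n(\mathcal A)$. Then the $\mathcal{D_L}$-topology on $\mathcal{CS}(\mathcal A)$ agrees with the BW-topology if and only if the image of $L_1^1=\{a\in\mathcal B:\|[D,a]\|\le1\}$ in $\mathcal B/(\mathbb C1)$ is totally bounded for the quotient norm $\|\cdot\|_1^\sim$.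
   Context: An unbounded Fredholm module $(\mathcal H,D)$ over a unital $C^*$-algebra $\mathcal A$ consists of a Hilbert space $\mathcal H$ with a $*$-representation of $\mathcal A$ on $\mathcal H$ (elements of $\mathcal A$ are identified with the operators by which they act), and an unbounded self-adjoint operator $D$ on $\mathcal H$ such that $\mathcal B=\{a\in\mathcal A:[D,a]$ is densely defined and extends to a bounded operator on $\mathcal H\}$ is norm dense in $\mathcal A$ and $(1+D^2)^{-1}$ is compact. The map $T:a\mapsto[D,a]$ (the bounded extension) is a densely defined derivation from $\mathcal A$ into $\mathcal B(\mathcal H)$ with domain $\mathcal B$. For $a=[a_{ij}]\in M_n(\mathcal B)$, $T_n(a)=[[D,a_{ij}]]\in M_n(\mathcal B(\mathcal H))=\mathcal B(\mathcal H^n)$ and $L_n(a)=\|T_n(a)\|$. $CS_n(\mathcal A)$ is the set of completely positive linear maps $\varphi:\mathcal A\to M_n=M_n(\mathbb C)$ with $\varphi(1)=1_n$. For $\varphi=[\varphi_{ij}]:\mathcal A\to M_n$ linear and $a=[a_{kl}]\in M_r(\mathcal A)$, $\ll\varphi,a\gg=[\varphi_{ij}(a_{kl})]\in M_{nr}$ (up to a canonical permutation of indices, this is $[\varphi(a_{kl})]\in M_r(M_n)$), with the operator norm. $D_{L_n}$ may take the value $+\infty$. The $\mathcal{D_L}$-topology is the topology induced on each $CS_n(\mathcal A)$ by $D_{L_n}$. The BW-topology is, on each $CS_n(\mathcal A)$, the topology of pointwise convergence on $\mathcal A$. The topologies agree on $\mathcal{CS}(\mathcal A)$ if they agree on $CS_n(\mathcal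 A)$ for every $n\in\mathbb N$. $\|\cdot\|_1^\sim$ is the quotient norm on $\mathcal B/(\mathbb C1)$ of the $C^*$-norm restricted to $\mathcal B$. *)

theory Defs
  imports "HOL-Analysis.Analysis"
begin

section \<open>Complex Hilbert spaces and unital C*-algebras\<close>

class complex_vector = real_vector +
  fixes scaleC :: "complex \<Rightarrow> 'a \<Rightarrow> 'a"  (infixr \<open>*\<^sub>C\<close> 75)
  assumes scaleC_add_right: "c *\<^sub>C (x + y) = c *\<^sub>C x + c *\<^sub>C y"
    and scaleC_add_left: "(c + d) *\<^sub>C x = c *\<^sub>C x + d *\<^sub>C x"
    and scaleC_scaleC: "c *\<^sub>C (d *\<^sub>C x) = (c * d) *\<^sub>C x"
    and scaleR_scaleC: "r *\<^sub>R x = complex_of_real r *\<^sub>C x"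

text \<open>The inner product is linear in the first and conjugate linear in the second argument.\<close>

class complex_hilbert_space = complex_vector + banach +
  fixes cinner :: "'a \<Rightarrow> 'a \<Rightarrow> complex"
  assumes cinner_add_left: "cinner (x + y) z = cinner x z + cinner y z"
    and cinner_scaleC_left: "cinner (c *\<^sub>C x) y = c * cinner x y"
    and cinner_commute: "cinner y x = cnj (cinner x y)"
    and cinner_self: "cinner x x = complex_of_real ((norm x)\<^sup>2)"

class unital_cstar_algebra = complex_vector + banach + real_normed_algebra_1 +
  fixes star :: "'a \<Rightarrow> 'a"
  assumes norm_scaleC: "norm (c *\<^sub>C x) = cmod c * norm x"
    and mult_scaleC_left: "(c *\<^sub>C x) * y = c *\<^sub>C (x * y)"
    and mult_scaleC_right: "x * (c *\<^sub>C y) = c *\<^sub>C (x * y)"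
    and star_star: "star (star x) = x"
    and star_add: "star (x + y) = star x + star y"
    and star_scaleC: "star (c *\<^sub>C x) = cnj c *\<^sub>C star x"
    and star_mult: "star (x * y) = star y * star x"
    and cstar_identity: "norm (star x * x) = (norm x)\<^sup>2"

instantiation complex :: unital_cstar_algebra
begin

definition scaleC_complex :: "complex \<Rightarrow> complex \<Rightarrow> complex"
  where "scaleC_complex c x = c * x"

definition star_complex :: "complex \<Rightarrow> complex"
  where "star_complex = cnj"

instance
  by standard
    (simp_all add: scaleC_complex_def star_complex_def algebra_simps scaleR_conv_of_real
      norm_mult power2_eq_square)

end


section \<open>Operators\<close>

definition bounded_clinear :: "('h::complex_hilbert_space \<Rightarrow> 'h) \<Rightarrow> bool"
  where "bounded_clinear X \<longleftrightarrow> bounded_linear X \<and> (\<forall>c x. X (c *\<^sub>C x) = c *\<^sub>C X x)"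

definition compact_operator :: "('h::complex_hilbert_space \<Rightarrow> 'h) \<Rightarrow> bool"
  where "compact_operator X \<longleftrightarrow> bounded_clinear X \<and> compact (closure (X ` cball 0 1))"

text \<open>An unbounded operator is given by its domain \<open>V\<close> together with a function \<open>D\<close> whose values
  outside \<open>V\<close> are never used.\<close>

definition densely_defined_operator ::
    "'h::complex_hilbert_space set \<Rightarrow> ('h \<Rightarrow> 'h) \<Rightarrow> bool"
  where "densely_defined_operator V D \<longleftrightarrow>
    closure V = UNIV \<and> 0 \<in> V \<and>
    (\<forall>x\<in>V. \<forall>y\<in>V. x + y \<in> V \<and> D (x + y) = D x + D y) \<and>
    (\<forall>c. \<forall>x\<in>V. c *\<^sub>C x \<in> V \<and> D (c *\<^sub>C x) = c *\<^sub>C D x)"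

text \<open>The second conjunct says that the graphs of \<open>D\<close> and of its adjoint coincide.\<close>

definition self_adjoint_operator ::
    "'h::complex_hilbert_space set \<Rightarrow> ('h \<Rightarrow> 'h) \<Rightarrow> bool"
  where "self_adjoint_operator V D \<longleftrightarrow>
    densely_defined_operator V D \<and>
    (\<forall>y z. (y \<in> V \<and> D y = z) \<longleftrightarrow> (\<forall>x\<in>V. cinner (D x) y = cinner x z))"

text \<open>\<open>1 + D\<^sup>2\<close> has domain \<open>{x \<in> V. D x \<in> V}\<close>, and \<open>R\<close> below is its inverse.\<close>

definition compact_resolvent ::
    "'h::complex_hilbert_space set \<Rightarrow> ('h \<Rightarrow> 'h) \<Rightarrow> bool"
  where "compact_resolvent V D \<longleftrightarrow>
    (\<exists>R. compact_operator R \<and>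
      (\<forall>y. R y \<in> V \<and> D (R y) \<in> V \<and> R y + D (D (R y)) = y) \<and>
      (\<forall>x\<in>V. D x \<in> V \<longrightarrow> R (x + D (D x)) = x))"

definition star_representation ::
    "('a::unital_cstar_algebra \<Rightarrow> 'h::complex_hilbert_space \<Rightarrow> 'h) \<Rightarrow> bool"
  where "star_representation \<pi> \<longleftrightarrow>
    (\<forall>a. bounded_clinear (\<pi> a)) \<and>
    (\<forall>a b x. \<pi> (a + b) x = \<pi> a x + \<pi> b x) \<and>
    (\<forall>c a x. \<pi> (c *\<^sub>C a) x = c *\<^sub>C \<pi> a x) \<and>
    (\<forall>a b x. \<pi> (a * b) x = \<pi> a (\<pi> b x)) \<and>
    (\<forall>a x y. cinner (\<pi> (star a) x) y = cinner x (\<pi> a y))"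


section \<open>Unbounded Fredholm modules\<close>

text \<open>\<open>[D, a]\<close> is the operator \<open>x \<mapsto> D (a x) - a (D x)\<close> on its natural domain. It is not required
  that \<open>a\<close> maps the domain of \<open>D\<close> into itself.\<close>

definition comm_dom ::
    "('a \<Rightarrow> 'h \<Rightarrow> 'h::complex_hilbert_space) \<Rightarrow> 'h set \<Rightarrow> 'a \<Rightarrow> 'h set"
  where "comm_dom \<pi> V a = {x \<in> V. \<pi> a x \<in> V}"

definition extends_comm ::
    "('a \<Rightarrow> 'h \<Rightarrow> 'h::complex_hilbert_space) \<Rightarrow> 'h set \<Rightarrow> ('h \<Rightarrow> 'h) \<Rightarrow> 'a \<Rightarrow> ('h \<Rightarrow> 'h) \<Rightarrow> bool"
  where "extends_comm \<pi> V D a X \<longleftrightarrow>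
    bounded_clinear X \<and> (\<forall>x\<in>comm_dom \<pi> V a. X x = D (\<pi> a x) - \<pi> a (D x))"

definition lipschitz_elements ::
    "('a \<Rightarrow> 'h \<Rightarrow> 'h::complex_hilbert_space) \<Rightarrow> 'h set \<Rightarrow> ('h \<Rightarrow> 'h) \<Rightarrow> 'a set"
  where "lipschitz_elements \<pi> V D =
    {a. closure (comm_dom \<pi> V a) = UNIV \<and> (\<exists>X. extends_comm \<pi> V D a X)}"

text \<open>For \<open>a \<in> lipschitz_elements \<pi> V D\<close> the bounded extension is unique by density.\<close>

definition commutator ::
    "('a \<Rightarrow> 'h \<Rightarrow> 'h::complex_hilbert_space) \<Rightarrow> 'h set \<Rightarrow> ('h \<Rightarrow> 'h) \<Rightarrow> 'a \<Rightarrow> ('h \<Rightarrow> 'h)"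
  where "commutator \<pi> V D a = (THE X. extends_comm \<pi> V D a X)"

definition unbounded_fredholm_module ::
    "('a::unital_cstar_algebra \<Rightarrow> 'h \<Rightarrow> 'h::complex_hilbert_space) \<Rightarrow> 'h set \<Rightarrow> ('h \<Rightarrow> 'h) \<Rightarrow> bool"
  where "unbounded_fredholm_module \<pi> V D \<longleftrightarrow>
    star_representation \<pi> \<and> self_adjoint_operator V D \<and> compact_resolvent V D \<and>
    closure (lipschitz_elements \<pi> V D) = UNIV"

text \<open>The set \<open>\<B>\<close> of Lipschitz elements is a linear subspace and \<open>a \<mapsto> [D, a]\<close> is linear on it. This is the linear part
  of the standing fact that \<open>a \<mapsto> [D, a]\<close> is a derivation with domain \<open>\<B>\<close>. It has to be required:
  since \<open>[D, a]\<close> is only asked to be densely defined, the domains of \<open>[D, a]\<close> and \<open>[D, b]\<close> may have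
  too small an intersection, and then \<open>a + b\<close> can fail to lie in \<open>\<B>\<close>.\<close>

definition commutator_linear ::
    "('a::unital_cstar_algebra \<Rightarrow> 'h \<Rightarrow> 'h::complex_hilbert_space) \<Rightarrow> 'h set \<Rightarrow> ('h \<Rightarrow> 'h) \<Rightarrow> bool"
  where "commutator_linear \<pi> V D \<longleftrightarrow>
    (\<forall>a\<in>lipschitz_elements \<pi> V D. \<forall>b\<in>lipschitz_elements \<pi> V D.
      a + b \<in> lipschitz_elements \<pi> V D \<and>
      commutator \<pi> V D (a + b) = (\<lambda>x. commutator \<pi> V D a x + commutator \<pi> V D b x)) \<and>
    (\<forall>c. \<forall>a\<in>lipschitz_elements \<pi> V D.
      c *\<^sub>C a \<in> lipschitz_elements \<pi> V D \<and>
      commutator \<pi> V D (c *\<^sub>C a) = (\<lambda>x. c *\<^sub>C commutator \<pi> V D a x))"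


section \<open>Matrices\<close>

text \<open>A square matrix is a function of two indices, restricted to a finite index set \<open>I\<close>;
  \<open>M\<^sub>n\<close> uses \<open>I = {..<n}\<close> and \<open>M\<^sub>n\<^sub>r\<close> uses \<open>I = {..<n} \<times> {..<r}\<close>. The norm of a matrix of operators is
  its operator norm on the Hilbert sum of copies of the space indexed by \<open>I\<close>.\<close>

definition op_matrix_norm ::
    "'i set \<Rightarrow> ('i \<Rightarrow> 'i \<Rightarrow> 'h::real_normed_vector \<Rightarrow> 'h) \<Rightarrow> real"
  where "op_matrix_norm I X =
    (SUP x \<in> {x. L2_set (\<lambda>j. norm (x j)) I \<le> 1}. L2_set (\<lambda>i. norm (\<Sum>j\<in>I. X i j (x j))) I)"

definition complex_matrix_norm :: "'i set \<Rightarrow> ('i \<Rightarrow> 'i \<Rightarrow> complex) \<Rightarrow> real"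
  where "complex_matrix_norm I m = op_matrix_norm I (\<lambda>i j z. m i j * z)"

text \<open>Positive elements of the C*-algebra of matrices over \<open>'a\<close> are those of the form \<open>b\<^sup>* b\<close>. This is
  used for matrices over \<open>\<A>\<close> and for complex matrices.\<close>

definition matrix_positive :: "'i set \<Rightarrow> ('i \<Rightarrow> 'i \<Rightarrow> 'a::unital_cstar_algebra) \<Rightarrow> bool"
  where "matrix_positive I a \<longleftrightarrow>
    (\<exists>b. \<forall>i\<in>I. \<forall>j\<in>I. a i j = (\<Sum>k\<in>I. star (b k i) * b k j))"

text \<open>\<open>\<lless>\<phi>, a\<ggreater> = [\<phi>\<^sub>i\<^sub>j (a\<^sub>k\<^sub>l)]\<close>, where \<open>\<phi> x i j\<close> is the \<open>(i, j)\<close> entry of \<open>\<phi> x\<close>.\<close>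

definition pairing ::
    "('a \<Rightarrow> nat \<Rightarrow> nat \<Rightarrow> complex) \<Rightarrow> (nat \<Rightarrow> nat \<Rightarrow> 'a) \<Rightarrow> nat \<times> nat \<Rightarrow> nat \<times> nat \<Rightarrow> complex"
  where "pairing \<phi> a = (\<lambda>(i, k) (j, l). \<phi> (a k l) i j)"


section \<open>The matrix state space\<close>

text \<open>Entries outside the \<open>n \<times> n\<close> block are fixed to be \<open>0\<close>, so that elements of \<open>matrix_states n\<close>
  correspond exactly to maps into \<open>M\<^sub>n\<close>.\<close>

definition matrix_states :: "nat \<Rightarrow> ('a::unital_cstar_algebra \<Rightarrow> nat \<Rightarrow> nat \<Rightarrow> complex) set"
  where "matrix_states n = {\<phi>.
    (\<forall>a i j. \<not> (i < n \<and> j < n) \<longrightarrow> \<phi> a i j = 0) \<and>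
    (\<forall>a b i j. \<phi> (a + b) i j = \<phi> a i j + \<phi> b i j) \<and>
    (\<forall>c a i j. \<phi> (c *\<^sub>C a) i j = c * \<phi> a i j) \<and>
    (\<forall>r\<ge>1. \<forall>a. matrix_positive {..<r} a \<longrightarrow> matrix_positive ({..<n} \<times> {..<r}) (pairing \<phi> a)) \<and>
    (\<forall>i<n. \<forall>j<n. \<phi> 1 i j = (if i = j then 1 else 0))}"

text \<open>The topology of the library on a function type is the product topology, so this is pointwise
  convergence on \<open>\<A>\<close> with entrywise (equivalently, norm) convergence in \<open>M\<^sub>n\<close>.\<close>

definition BW_topology :: "nat \<Rightarrow> ('a::unital_cstar_algebra \<Rightarrow> nat \<Rightarrow> nat \<Rightarrow> complex) topology"
  where "BW_topology n = subtopology euclidean (matrix_states n)"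

definition lipschitz_matrix_ball ::
    "('a \<Rightarrow> 'h \<Rightarrow> 'h::complex_hilbert_space) \<Rightarrow> 'h set \<Rightarrow> ('h \<Rightarrow> 'h) \<Rightarrow> nat \<Rightarrow> (nat \<Rightarrow> nat \<Rightarrow> 'a) set"
  where "lipschitz_matrix_ball \<pi> V D r = {a.
    (\<forall>i<r. \<forall>j<r. a i j \<in> lipschitz_elements \<pi> V D) \<and>
    op_matrix_norm {..<r} (\<lambda>i j. commutator \<pi> V D (a i j)) \<le> 1}"

definition matrix_metric ::
    "('a \<Rightarrow> 'h \<Rightarrow> 'h::complex_hilbert_space) \<Rightarrow> 'h set \<Rightarrow> ('h \<Rightarrow> 'h) \<Rightarrow> nat \<Rightarrow>
      ('a \<Rightarrow> nat \<Rightarrow> nat \<Rightarrow> complex) \<Rightarrow> ('a \<Rightarrow> nat \<Rightarrow> nat \<Rightarrow> complex) \<Rightarrow> ennreal"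
  where "matrix_metric \<pi> V D n \<phi> \<psi> =
    (SUP r\<in>{1..}. SUP a\<in>lipschitz_matrix_ball \<pi> V D r.
      ennreal (complex_matrix_norm ({..<n} \<times> {..<r}) (\<lambda>p q. pairing \<phi> a p q - pairing \<psi> a p q)))"

definition metric_open :: "'b set \<Rightarrow> ('b \<Rightarrow> 'b \<Rightarrow> ennreal) \<Rightarrow> 'b set \<Rightarrow> bool"
  where "metric_open S d U \<longleftrightarrow> U \<subseteq> S \<and> (\<forall>x\<in>U. \<exists>e>0. \<forall>y\<in>S. d x y < e \<longrightarrow> y \<in> U)"

lemma istopology_metric_open: "istopology (metric_open S d)"
  unfolding istopology_def
proof (intro conjI allI impI)
  fix U W assume U: "metric_open S d U" and W: "metric_open S d W"
  show "metric_open S d (U \<inter> W)"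
    unfolding metric_open_def
  proof (intro conjI ballI)
    show "U \<inter> W \<subseteq> S" using U by (auto simp: metric_open_def)
    fix x assume x: "x \<in> U \<inter> W"
    obtain e where e: "e > 0" "\<forall>y\<in>S. d x y < e \<longrightarrow> y \<in> U"
      using U x by (auto simp: metric_open_def)
    obtain e' where e': "e' > 0" "\<forall>y\<in>S. d x y < e' \<longrightarrow> y \<in> W"
      using W x by (auto simp: metric_open_def)
    show "\<exists>e>0. \<forall>y\<in>S. d x y < e \<longrightarrow> y \<in> U \<inter> W"
      using e e' by (intro exI[of _ "min e e'"]) auto
  qed
next
  fix K assume K: "\<forall>U\<in>K. metric_open S d U"
  show "metric_open S d (\<Union>K)"
    unfolding metric_open_def
  proof (intro conjI ballI)
    show "\<Union>K \<subseteq> S" using K by (auto simp: metric_open_def)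
    fix x assume "x \<in> \<Union>K"
    then obtain U where U: "U \<in> K" "x \<in> U" by blast
    then obtain e where "e > 0" "\<forall>y\<in>S. d x y < e \<longrightarrow> y \<in> U"
      using K unfolding metric_open_def by metis
    then show "\<exists>e>0. \<forall>y\<in>S. d x y < e \<longrightarrow> y \<in> \<Union>K" using U by blast
  qed
qed

definition DL_topology ::
    "('a::unital_cstar_algebra \<Rightarrow> 'h \<Rightarrow> 'h::complex_hilbert_space) \<Rightarrow> 'h set \<Rightarrow> ('h \<Rightarrow> 'h) \<Rightarrow> nat \<Rightarrow>
      ('a \<Rightarrow> nat \<Rightarrow> nat \<Rightarrow> complex) topology"
  where "DL_topology \<pi> V D n = topology (metric_open (matrix_states n) (matrix_metric \<pi> V D n))"


section \<open>The quotient by the scalars\<close>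

definition scalar_coset :: "'a::unital_cstar_algebra \<Rightarrow> 'a set"
  where "scalar_coset a = range (\<lambda>c. a + c *\<^sub>C 1)"

text \<open>For a coset \<open>P\<close>, \<open>infdist 0 P\<close> is the infimum of the norms of its elements.\<close>

definition quotient_norm :: "'a::unital_cstar_algebra set \<Rightarrow> real"
  where "quotient_norm P = infdist 0 P"

definition quotient_dist :: "'a::unital_cstar_algebra set \<Rightarrow> 'a set \<Rightarrow> real"
  where "quotient_dist P Q = quotient_norm {p - q | p q. p \<in> P \<and> q \<in> Q}"

lemma scaleC_diff_left: "(c - d) *\<^sub>C (x::'a::complex_vector) = c *\<^sub>C x - d *\<^sub>C x"
  using scaleC_add_left[of "c - d" d x] by simp

lemma scaleC_zero_left [simp]: "0 *\<^sub>C (x::'a::complex_vector) = 0"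
  using scaleC_diff_left[of 0 0 x] by simp

lemma quotient_dist_coset:
  "quotient_dist (scalar_coset a) (scalar_coset b) = quotient_norm (scalar_coset (a - b))"
proof -
  have "{p - q | p q. p \<in> scalar_coset a \<and> q \<in> scalar_coset b} = scalar_coset (a - b)"
  proof (intro equalityI subsetI)
    fix x assume "x \<in> {p - q | p q. p \<in> scalar_coset a \<and> q \<in> scalar_coset b}"
    then obtain c d where "x = (a + c *\<^sub>C 1) - (b + d *\<^sub>C 1)" by (auto simp: scalar_coset_def)
    then have "x = (a - b) + (c - d) *\<^sub>C 1" by (simp add: scaleC_diff_left)
    then show "x \<in> scalar_coset (a - b)" by (auto simp: scalar_coset_def)
  next
    fix x assume "x \<in> scalar_coset (a - b)"
    then obtain c where "x = (a - b) + c *\<^sub>C 1" by (auto simp: scalar_coset_def)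
    then have "x = (a + c *\<^sub>C 1) - (b + 0 *\<^sub>C 1)" by simp
    then show "x \<in> {p - q | p q. p \<in> scalar_coset a \<and> q \<in> scalar_coset b}"
      unfolding scalar_coset_def by blast
  qed
  then show ?thesis by (simp add: quotient_dist_def)
qed

lemma closed_scalar_coset: "closed (scalar_coset (a::'a::unital_cstar_algebra))"
proof -
  have "bounded_linear (\<lambda>c. c *\<^sub>C (1::'a))"
    by (rule bounded_linear_intro[where K = 1])
      (simp_all add: scaleC_add_left scaleR_scaleC scaleC_scaleC scaleC_complex_def norm_scaleC)
  then have "complete ((\<lambda>c. c *\<^sub>C (1::'a)) ` UNIV)"
    by (intro complete_isometric_image[where e = 1])
      (auto simp: norm_scaleC complete_UNIV)
  then have "closed ((+) a ` range (\<lambda>c. c *\<^sub>C (1::'a)))"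
    by (intro closed_translation complete_imp_closed)
  then show ?thesis by (simp add: scalar_coset_def image_image)
qed

lemma quotient_metric_space: "Metric_space (scalar_coset ` S) quotient_dist"
proof
  fix P Q R :: "'a set"
  show "0 \<le> quotient_dist P Q"
    by (simp add: quotient_dist_def quotient_norm_def infdist_nonneg)
  have "dist 0 ` {p - q | p q. p \<in> P \<and> q \<in> Q} \<subseteq> dist 0 ` {p - q | p q. p \<in> Q \<and> q \<in> P}"
    for P Q :: "'a set"
    by (force simp: image_iff norm_minus_commute)
  then have *: "dist 0 ` {p - q | p q. p \<in> P \<and> q \<in> Q} = dist 0 ` {p - q | p q. p \<in> Q \<and> q \<in> P}"
    by blast
  show "quotient_dist P Q = quotient_dist Q P"
    unfolding quotient_dist_def quotient_norm_def infdist_def * by auto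
  assume "P \<in> scalar_coset ` S" "Q \<in> scalar_coset ` S"
  then obtain a b where ab: "P = scalar_coset a" "Q = scalar_coset b" by blast
  have ne: "scalar_coset x \<noteq> {}" for x :: 'a by (simp add: scalar_coset_def)
  have mem: "scalar_coset x = scalar_coset y" if xy: "0 \<in> scalar_coset (x - y)" for x y :: 'a
  proof -
    obtain c where "0 = (x - y) + c *\<^sub>C 1" using xy by (auto simp: scalar_coset_def)
    then have y: "y = x + c *\<^sub>C 1" by (simp add: algebra_simps)
    have "x + d *\<^sub>C 1 = y + (d - c) *\<^sub>C 1" "y + d *\<^sub>C 1 = x + (c + d) *\<^sub>C 1" for d
      by (simp_all add: y scaleC_diff_left scaleC_add_left)
    then show ?thesis unfolding scalar_coset_def by (metis (mono_tags) rangeE rangeI subsetI subset_antisym)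
  qed
  show "quotient_dist P Q = 0 \<longleftrightarrow> P = Q"
  proof
    assume "quotient_dist P Q = 0"
    then have "0 \<in> scalar_coset (a - b)"
      using in_closed_iff_infdist_zero[OF closed_scalar_coset ne]
      by (simp add: ab quotient_dist_coset quotient_norm_def)
    then show "P = Q" using mem ab by blast
  next
    assume PQ: "P = Q"
    have "0 \<in> scalar_coset (a - a)"
      unfolding scalar_coset_def by (rule range_eqI[of _ _ 0]) simp
    then show "quotient_dist P Q = 0"
      unfolding PQ[symmetric] ab quotient_dist_coset quotient_norm_def by simp
  qed
  assume "R \<in> scalar_coset ` S"
  then obtain c where c: "R = scalar_coset c" by blast
  have "infdist 0 (scalar_coset (a - c)) \<le> dist 0 x + dist 0 y"
    if x: "x \<in> scalar_coset (a - b)" and y: "y \<in> scalar_coset (b - c)" for x y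
  proof -
    obtain s where s: "x = (a - b) + s *\<^sub>C 1" using x by (auto simp: scalar_coset_def)
    obtain t where t: "y = (b - c) + t *\<^sub>C 1" using y by (auto simp: scalar_coset_def)
    have "x + y = (a - c) + (s + t) *\<^sub>C 1" by (simp add: s t scaleC_add_left)
    then have "x + y \<in> scalar_coset (a - c)" unfolding scalar_coset_def by blast
    then have "infdist 0 (scalar_coset (a - c)) \<le> dist 0 (x + y)" by (rule infdist_le)
    also have "\<dots> \<le> dist 0 x + dist 0 y" by (simp add: norm_triangle_ineq)
    finally show ?thesis .
  qed
  then have "infdist 0 (scalar_coset (a - c)) - dist 0 y \<le> infdist 0 (scalar_coset (a - b))"
    if y: "y \<in> scalar_coset (b - c)" for y
    using y ne unfolding infdist_notempty[OF ne[of "a - b"]]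
    by (intro cINF_greatest) (auto simp: algebra_simps)
  then have "infdist 0 (scalar_coset (a - c)) - infdist 0 (scalar_coset (a - b))
      \<le> infdist 0 (scalar_coset (b - c))"
    unfolding infdist_notempty[OF ne[of "b - c"]]
    by (intro cINF_greatest ne) (simp add: algebra_simps)
  then show "quotient_dist P R \<le> quotient_dist P Q + quotient_dist Q R"
    by (simp add: ab c quotient_dist_coset quotient_norm_def)
qed

definition lipschitz_ball ::
    "('a \<Rightarrow> 'h \<Rightarrow> 'h::complex_hilbert_space) \<Rightarrow> 'h set \<Rightarrow> ('h \<Rightarrow> 'h) \<Rightarrow> 'a set"
  where "lipschitz_ball \<pi> V D = {a \<in> lipschitz_elements \<pi> V D. onorm (commutator \<pi> V D a) \<le> 1}"

end

theory Submission
  imports Defs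
begin

text \<open>Compressing \<open>a \<in> M\<^sub>r(\<B>)\<close> with \<open>L\<^sub>r(a) \<le> 1\<close> by unit vectors \<open>u, v\<close> gives an element
  \<open>u a v\<close> of the Lipschitz ball \<open>L\<^sub>1\<^sup>1\<close>, because \<open>[D, u a v] = u [D, a] v\<close>. Hence \<open>D\<^bsub>L\<^sub>n\<^esub>(\<phi>, \<psi>)\<close> is
  bounded, uniformly in \<open>r\<close>, by \<open>n\<^sup>2\<close> times the supremum of \<open>\<bar>\<phi>\<^sub>i\<^sub>j(a) - \<psi>\<^sub>i\<^sub>j(a)\<bar>\<close> over \<open>a \<in> L\<^sub>1\<^sup>1\<close>. If the
  ball is totally bounded modulo scalars, finitely many \<open>a\<close> control this supremum, so the metric is
  continuous for the BW-topology; the other inclusion of topologies only needs that \<open>\<B>\<close> is dense.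

  Conversely, for \<open>n = 1\<close> the state space is compact and convex. Compactness gives finitely many
  states that approximate every state uniformly on \<open>L\<^sub>1\<^sup>1\<close>, and moving along a segment shows that two
  states differ boundedly on \<open>L\<^sub>1\<^sup>1\<close>. As in the Arzela-Ascoli theorem, this gives a finite net, since
  states determine the norm of the \<open>C\<^sup>*\<close>-algebra up to a constant. The last fact is
  proved without spectral theory, by defining \<open>h \<ge> 0\<close> as \<open>\<parallel>t - h\<parallel> \<le> t\<close> for some \<open>t \<ge> 0\<close>.\<close>


section \<open>Positive elements of C*-algebras\<close>

lemma scaleC_one [simp]: "1 *\<^sub>C (x::'a::complex_vector) = x"
  using scaleR_scaleC[of 1 x] by simp

lemma scaleC_minus_left: "(- c) *\<^sub>C (x::'a::complex_vector) = - (c *\<^sub>C x)"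
  using scaleC_diff_left[of 0 c x] by simp

lemma scaleC_zero_right [simp]: "c *\<^sub>C (0::'a::complex_vector) = 0"
  using scaleC_add_right[of c "0::'a" 0] by simp

lemma scaleC_minus_right: "c *\<^sub>C (- x) = - (c *\<^sub>C (x::'a::complex_vector))"
  using scaleC_add_right[of c x "- x"] by (simp add: eq_neg_iff_add_eq_0 add.commute)

lemma scaleC_diff_right: "c *\<^sub>C (x - y) = c *\<^sub>C x - c *\<^sub>C (y::'a::complex_vector)"
  using scaleC_add_right[of c x "- y"] by (simp add: scaleC_minus_right)

lemma scaleC_sum_right: "c *\<^sub>C (\<Sum>i\<in>I. f i) = (\<Sum>i\<in>I. c *\<^sub>C (f i :: 'a::complex_vector))"
  by (induction I rule: infinite_finite_induct) (simp_all add: scaleC_add_right)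

lemma star_zero [simp]: "star (0::'a::unital_cstar_algebra) = 0"
  using star_add[of "0::'a" 0] by simp

lemma star_minus: "star (- x) = - star (x::'a::unital_cstar_algebra)"
  using star_add[of x "- x"] by (simp add: eq_neg_iff_add_eq_0 add.commute)

lemma star_diff: "star (x - y) = star x - star (y::'a::unital_cstar_algebra)"
  using star_add[of x "- y"] by (simp add: star_minus)

lemma star_scaleR: "star (r *\<^sub>R x) = r *\<^sub>R star (x::'a::unital_cstar_algebra)"
  by (simp add: scaleR_scaleC star_scaleC)

lemma star_one [simp]: "star (1::'a::unital_cstar_algebra) = 1"
  using star_mult[of "star (1::'a)" 1] by (simp add: star_star)

text \<open>The C*-identity gives \<open>(norm x)\<^sup>2 = norm (star x * x) \<le> norm (star x) *
  norm x\<close>; this is applied to \<open>x\<close> and to \<open>star x\<close>.\<close>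

lemma norm_star [simp]: "norm (star x) = norm (x::'a::unital_cstar_algebra)"
proof -
  have le: "norm x \<le> norm (star x)" for x :: 'a
  proof (cases "x = 0")
    case False
    have "norm x * norm x \<le> norm (star x) * norm x"
      using norm_mult_ineq[of "star x" x] by (simp add: cstar_identity power2_eq_square)
    then show ?thesis using False by simp
  qed simp
  show ?thesis using le[of x] le[of "star x"] by (simp add: star_star)
qed

lemma bounded_linear_star: "bounded_linear (star :: 'a::unital_cstar_algebra \<Rightarrow> 'a)"
  by (rule bounded_linear_intro[where K = 1]) (simp_all add: star_add star_scaleR)

definition re_part :: "'a::unital_cstar_algebra \<Rightarrow> 'a"
  where "re_part a = (1/2) *\<^sub>R (a + star a)"

definition im_part :: "'a::unital_cstar_algebra \<Rightarrow> 'a"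
  where "im_part a = (- \<i> / 2) *\<^sub>C (a - star a)"

lemma star_re_part [simp]: "star (re_part a) = re_part a"
  by (simp add: re_part_def star_scaleR star_add star_star add.commute)

lemma star_im_part [simp]: "star (im_part a) = im_part a"
  by (simp add: im_part_def star_scaleC star_diff star_star scaleC_diff_right scaleC_minus_left)

lemma re_im_part: "a = re_part a + \<i> *\<^sub>C im_part a"
proof -
  have "\<i> *\<^sub>C im_part a = (1/2) *\<^sub>R (a - star a)"
    by (simp add: im_part_def scaleC_scaleC scaleR_scaleC)
  then show ?thesis
    by (simp add: re_part_def flip: scaleR_add_right)
qed

lemma norm_re_part_le: "norm (re_part a) \<le> norm a"
  using norm_triangle_ineq[of a "star a"] by (simp add: re_part_def)

lemma norm_im_part_le: "norm (im_part a) \<le> norm a"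
  using norm_triangle_ineq4[of a "star a"] by (simp add: im_part_def norm_scaleC)

section \<open>Norms of squares and square roots of self-adjoint elements\<close>

lemma norm_square_self_adjoint:
  "star h = h \<Longrightarrow> norm (h * h) = (norm (h::'a::unital_cstar_algebra))\<^sup>2"
  using cstar_identity[of h] by simp

text \<open>\<open>x\<close> is the real part of \<open>x + \<i> y\<close>, whose \<open>C\<^sup>*\<close>-square is \<open>x\<^sup>2 + y\<^sup>2\<close>.\<close>

lemma norm_square_le_sum_squares:
  fixes x y :: "'a::unital_cstar_algebra"
  assumes "star x = x" "star y = y" "x * y = y * x"
  shows "(norm x)\<^sup>2 \<le> norm (x * x + y * y)"
proof -
  define w where "w = x + \<i> *\<^sub>C y"
  have sw: "star w = x - \<i> *\<^sub>C y"
    using assms by (simp add: w_def star_add star_scaleC scaleC_minus_left)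
  have "star w * w = x * x + y * y"
    using assms(3) by (simp add: sw) (simp add: w_def algebra_simps mult_scaleC_left mult_scaleC_right
        scaleC_add_right scaleC_diff_right scaleC_scaleC scaleC_minus_left)
  then have "norm (x * x + y * y) = (norm w)\<^sup>2" by (metis cstar_identity)
  moreover have "re_part w = x" unfolding re_part_def sw
    by (simp add: w_def flip: scaleR_add_left)
  then have "norm x \<le> norm w" using norm_re_part_le[of w] by simp
  ultimately show ?thesis by (simp add: power_mono)
qed

text \<open>\<open>w\<close> with \<open>(1 - w)\<^sup>2 = 1 - x\<close> is the limit of \<open>w \<mapsto> (x + w\<^sup>2)/2\<close> from \<open>0\<close>; the scalar
  iteration with \<open>x = 1\<close> majorises it, so there is convergence even for \<open>norm x = 1\<close>.\<close>

primrec sqrt_iter :: "'a::real_normed_algebra_1 \<Rightarrow> nat \<Rightarrow> 'a" where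
  "sqrt_iter x 0 = 0"
| "sqrt_iter x (Suc k) = (1/2) *\<^sub>R (x + sqrt_iter x k * sqrt_iter x k)"

lemma sqrt_iter_real_bounds:
  "0 \<le> sqrt_iter (1::real) k \<and> sqrt_iter (1::real) k \<le> 1"
proof (induction k)
  case (Suc k)
  then have "sqrt_iter (1::real) k * sqrt_iter 1 k \<le> 1 * 1" by (intro mult_mono) auto
  then show ?case using Suc by simp
qed simp

lemma norm_sqrt_iter_le: 
  assumes "norm x \<le> 1"
  shows "norm (sqrt_iter x k) \<le> sqrt_iter 1 k"
proof (induction k)
  case (Suc k)
  have "norm (sqrt_iter x k * sqrt_iter x k) \<le> sqrt_iter 1 k * sqrt_iter 1 k"
    using Suc by (intro order_trans[OF norm_mult_ineq] mult_mono)
      (auto simp: sqrt_iter_real_bounds)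
  then have "norm (x + sqrt_iter x k * sqrt_iter x k) \<le> 1 + sqrt_iter 1 k * sqrt_iter 1 k"
    using assms norm_triangle_ineq[of x "sqrt_iter x k * sqrt_iter x k"] by linarith
  then show ?case by simp
qed simp

text \<open>The splitting \<open>u * u - v * v = u * (u - v) + (u - v) * v\<close> needs no
  commutativity, and for the scalar iteration the corresponding bound
  \<open>s * (s - t) + (s - t) * t\<close> is exactly \<open>s * s - t * t\<close>.\<close>

lemma norm_sqrt_iter_step_le:
  assumes "norm x \<le> 1"
  shows "norm (sqrt_iter x (Suc k) - sqrt_iter x k) \<le> sqrt_iter 1 (Suc k) - sqrt_iter 1 k"
proof (induction k)
  case 0 then show ?case using assms by simp
next
  case (Suc k)
  define u v where "u = sqrt_iter x (Suc k)" and "v = sqrt_iter x k"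
  define s t :: real where "s = sqrt_iter 1 (Suc k)" and "t = sqrt_iter 1 k"
  have uv: "norm u \<le> s" "norm v \<le> t" "norm (u - v) \<le> s - t"
    using norm_sqrt_iter_le[OF assms, of "Suc k"] norm_sqrt_iter_le[OF assms, of k] Suc
    by (simp_all only: u_def v_def s_def t_def)
  have "u * u - v * v = u * (u - v) + (u - v) * v" by (simp add: algebra_simps)
  also have "norm \<dots> \<le> norm u * norm (u - v) + norm (u - v) * norm v"
    by (intro order_trans[OF norm_triangle_ineq] add_mono norm_mult_ineq)
  also have "\<dots> \<le> s * (s - t) + (s - t) * t"
    using uv norm_ge_zero[of u] norm_ge_zero[of "u - v"]
      order_trans[OF norm_ge_zero uv(1)] order_trans[OF norm_ge_zero uv(2)]
      order_trans[OF norm_ge_zero uv(3)]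
    by (intro add_mono mult_mono) auto
  also have "\<dots> = s * s - t * t" by (simp add: algebra_simps)
  finally have "norm (u * u - v * v) \<le> s * s - t * t" .
  moreover have "sqrt_iter x (Suc (Suc k)) - sqrt_iter x (Suc k) = (1/2) *\<^sub>R (u * u - v * v)"
    unfolding sqrt_iter.simps(2)[of x "Suc k"] u_def[symmetric]
    unfolding u_def v_def sqrt_iter.simps(2)[of x k] by (simp add: algebra_simps)
  moreover have "sqrt_iter (1::real) (Suc (Suc k)) - sqrt_iter 1 (Suc k) = (1/2) * (s * s - t * t)"
    unfolding sqrt_iter.simps(2)[of "1::real" "Suc k"] s_def[symmetric]
    unfolding s_def t_def sqrt_iter.simps(2)[of "1::real" k] by (simp add: algebra_simps)
  ultimately show ?case by (simp only: norm_scaleR) simp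
qed

text \<open>The scalar iterates increase and stay below 1, so their increments are summable; they
  dominate the increments of \<open>sqrt_iter x\<close>.\<close>

lemma convergent_sqrt_iter:
  fixes x :: "'a::{real_normed_algebra_1, banach}"
  assumes "norm x \<le> 1"
  shows "convergent (sqrt_iter x)"
proof -
  have "incseq (sqrt_iter (1::real))"
  proof (rule incseq_SucI)
    fix k
    show "sqrt_iter (1::real) k \<le> sqrt_iter 1 (Suc k)"
      \<comment> \<open>For the scalar 1 the increment bound says that an increment is at least its
        own absolute value.\<close>
      using order_trans[OF norm_ge_zero norm_sqrt_iter_step_le[of "1::real" k]] by simp
  qed
  moreover have "\<forall>k. sqrt_iter (1::real) k \<le> 1" using sqrt_iter_real_bounds by blast
  ultimately obtain l where "sqrt_iter (1::real) \<longlonglongrightarrow> l"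
    by (rule incseq_convergent)
  then have "summable (\<lambda>k. sqrt_iter (1::real) (Suc k) - sqrt_iter 1 k)"
    by (rule telescope_summable)
  then have "summable (\<lambda>k. sqrt_iter x (Suc k) - sqrt_iter x k)"
    by (rule summable_comparison_test'[where N = 0]) (rule norm_sqrt_iter_step_le[OF assms])
  then have "(\<lambda>n. \<Sum>k<n. sqrt_iter x (Suc k) - sqrt_iter x k)
      \<longlonglongrightarrow> (\<Sum>k. sqrt_iter x (Suc k) - sqrt_iter x k)"
    by (rule summable_LIMSEQ)
  then have "sqrt_iter x \<longlonglongrightarrow> (\<Sum>k. sqrt_iter x (Suc k) - sqrt_iter x k)"
    unfolding sum_lessThan_telescope by simp
  then show ?thesis by (rule convergentI)
qed

text \<open>Take \<open>s = 1 - w\<close> for the limit \<open>w\<close> of the iteration.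
  Self-adjointness and commutation pass from the iterates to the limit. The bound on
  \<open>1 - s\<close> makes \<open>s\<close> a nonnegative element later on, and the commutation
  clause stands in for functional calculus.\<close>

lemma square_root_one_minus:
  fixes x :: "'a::unital_cstar_algebra"
  assumes "norm x \<le> 1" "star x = x"
  shows "\<exists>s. s * s = 1 - x \<and> star s = s \<and> norm (1 - s) \<le> 1 \<and> (\<forall>y. x * y = y * x \<longrightarrow> s * y = y * s)"
proof -
  obtain w where w: "sqrt_iter x \<longlonglongrightarrow> w"
    using convergent_sqrt_iter[OF assms(1)] by (auto simp: convergent_def)
  have "(\<lambda>k. sqrt_iter x (Suc k)) \<longlonglongrightarrow> (1/2) *\<^sub>R (x + w * w)"
    unfolding sqrt_iter.simps by (intro tendsto_intros w)
  with LIMSEQ_Suc[OF w] have "w = (1/2) *\<^sub>R (x + w * w)" by (rule LIMSEQ_unique)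
  then have "w + w = (1/2) *\<^sub>R (x + w * w) + (1/2) *\<^sub>R (x + w * w)" by (intro arg_cong2[where f = "(+)"])
  then have ww: "w + w = x + w * w" by (simp flip: scaleR_add_left)
  have "(1 - w) * (1 - w) = 1 - (w + w) + w * w" by (simp add: algebra_simps)
  then have "(1 - w) * (1 - w) = 1 - x" unfolding ww by simp
  moreover have "norm (1 - (1 - w)) \<le> 1"
    unfolding diff_diff_eq2 add_diff_cancel_left'
  proof (rule Lim_bounded[OF tendsto_norm[OF w]], intro allI impI)
    fix k show "norm (sqrt_iter x k) \<le> 1"
      using norm_sqrt_iter_le[OF assms(1), of k] sqrt_iter_real_bounds[of k] by linarith
  qed
  moreover have "star (1 - w) = 1 - w"
  proof -
    have "star (sqrt_iter x k) = sqrt_iter x k" for k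
      using assms(2) by (induction k) (simp_all add: star_scaleR star_add star_mult)
    then have "sqrt_iter x \<longlonglongrightarrow> star w"
      using bounded_linear.tendsto[OF bounded_linear_star w] by simp
    then have "star w = w" using w by (rule LIMSEQ_unique)
    then show ?thesis by (simp add: star_diff)
  qed
  moreover have "(1 - w) * y = y * (1 - w)" if "x * y = y * x" for y
  proof -
    have "sqrt_iter x k * y = y * sqrt_iter x k" for k
    proof (induction k)
      case (Suc k)
      then have "sqrt_iter x k * sqrt_iter x k * y = y * (sqrt_iter x k * sqrt_iter x k)"
        by (metis mult.assoc)
      then show ?case by (simp add: that algebra_simps)
    qed simp
    then have "(\<lambda>k. y * sqrt_iter x k) \<longlonglongrightarrow> w * y"
      using tendsto_mult[OF w tendsto_const[of y]] by simp
    then have "w * y = y * w" using tendsto_mult[OF tendsto_const[of y] w] by (rule LIMSEQ_unique)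
    then show ?thesis by (simp add: left_diff_distrib right_diff_distrib)
  qed
  ultimately show ?thesis
    by blast
qed

section \<open>Nonnegative elements and the positivity of \<open>star b * b\<close>\<close>

text \<open>In spectral terms the norm condition places the spectrum of \<open>h\<close> in
  \<open>[0, 2 t]\<close>. In this form, closure under sums is just the triangle inequality.\<close>

definition nonneg_element :: "'a::unital_cstar_algebra \<Rightarrow> bool"
  where "nonneg_element h \<longleftrightarrow> star h = h \<and> (\<exists>t\<ge>0. norm (t *\<^sub>R 1 - h) \<le> t)"

lemma nonneg_element_add:
  assumes "nonneg_element h" "nonneg_element k"
  shows "nonneg_element (h + k)"
proof -
  obtain s t where st: "s \<ge> 0" "norm (s *\<^sub>R 1 - h) \<le> s" "t \<ge> 0" "norm (t *\<^sub>R 1 - k) \<le> t"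
    using assms by (auto simp: nonneg_element_def)
  have *: "(s + t) *\<^sub>R 1 - (h + k) = (s *\<^sub>R 1 - h) + (t *\<^sub>R 1 - k)" by (simp add: algebra_simps)
  have "norm ((s + t) *\<^sub>R 1 - (h + k)) \<le> s + t"
    unfolding * using norm_triangle_ineq[of "s *\<^sub>R 1 - h" "t *\<^sub>R 1 - k"] st by linarith
  then show ?thesis using assms st
    by (auto simp: nonneg_element_def star_add intro!: exI[of _ "s + t"])
qed

lemma nonneg_element_scaleR:
  assumes "nonneg_element h" "c \<ge> 0"
  shows "nonneg_element (c *\<^sub>R h)"
proof -
  obtain t where t: "t \<ge> 0" "norm (t *\<^sub>R 1 - h) \<le> t" using assms by (auto simp: nonneg_element_def)
  have "(c * t) *\<^sub>R 1 - c *\<^sub>R h = c *\<^sub>R (t *\<^sub>R 1 - h)" by (simp add: algebra_simps)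
  then have "norm ((c * t) *\<^sub>R 1 - c *\<^sub>R h) \<le> c * t" using t assms by (simp add: mult_left_mono)
  then show ?thesis using assms t
    by (auto simp: nonneg_element_def star_scaleR intro!: exI[of _ "c * t"])
qed

lemma nonneg_element_one [simp]: "nonneg_element 1"
  by (auto simp: nonneg_element_def intro!: exI[of _ 1])

lemma nonneg_element_norm_add:
  "star h = h \<Longrightarrow> nonneg_element (norm h *\<^sub>R 1 + h)"
  by (auto simp: nonneg_element_def star_add star_scaleR intro!: exI[of _ "norm h"])

text \<open>For \<open>t > 0\<close>, dividing by \<open>t\<close> writes \<open>h\<close> as
  \<open>t\<close> times \<open>1 - x\<close> with \<open>norm x \<le> 1\<close>, and
  \<open>1 - x\<close> has a square root. For \<open>t = 0\<close> the element is 0.\<close>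

lemma nonneg_element_square_root:
  assumes "nonneg_element h"
  shows "\<exists>s. s * s = h \<and> nonneg_element s \<and> (\<forall>y. h * y = y * h \<longrightarrow> s * y = y * s)"
proof -
  obtain t where t: "t \<ge> 0" "norm (t *\<^sub>R 1 - h) \<le> t" and h: "star h = h"
    using assms by (auto simp: nonneg_element_def)
  show ?thesis
  proof (cases "t = 0")
    case True
    then show ?thesis using t by (auto simp: nonneg_element_def intro!: exI[of _ 0])
  next
    case False
    define x where "x = (1/t) *\<^sub>R (t *\<^sub>R 1 - h)"
    have x: "x = 1 - (1/t) *\<^sub>R h" using False by (simp add: x_def algebra_simps)
    have "norm x \<le> 1" "star x = x"
      using t False h by (auto simp: x_def star_scaleR star_diff divide_simps)
    then obtain s where s: "s * s = 1 - x" "star s = s" "norm (1 - s) \<le> 1"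
      and sc: "\<And>y. x * y = y * x \<Longrightarrow> s * y = y * s" by (metis square_root_one_minus)
    have "(sqrt t *\<^sub>R s) * (sqrt t *\<^sub>R s) = h" using s(1) t False by (simp add: x)
    moreover have "nonneg_element (sqrt t *\<^sub>R s)"
      using s t by (intro nonneg_element_scaleR) (auto simp: nonneg_element_def intro!: exI[of _ 1])
    moreover have "(sqrt t *\<^sub>R s) * y = y * (sqrt t *\<^sub>R s)" if "h * y = y * h" for y
      using sc[of y] that by (simp add: x algebra_simps)
    ultimately show ?thesis by blast
  qed
qed

text \<open>For \<open>norm h \<le> 1\<close> there is a self-adjoint \<open>u\<close> commuting
  with \<open>h\<close> such that \<open>u * u + h * h = 1\<close>; then
  \<open>norm (1 - h * h) = (norm u)\<^sup>2 \<le> 1\<close>. The general case follows by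
  scaling.\<close>

lemma nonneg_element_square:
  assumes "star h = h"
  shows "nonneg_element (h * h)"
proof -
  have unit: "nonneg_element (h * h)" if h: "star h = h" "norm h \<le> 1" for h :: 'a
  proof -
    have "norm (h * h) \<le> 1" using h by (simp add: norm_square_self_adjoint power_le_one)
    then obtain u where u: "u * u = 1 - h * h" "star u = u" "u * h = h * u"
      using square_root_one_minus[of "h * h"] h by (metis mult.assoc star_mult)
    then have "norm (1 - h * h) \<le> 1"
      using norm_square_le_sum_squares[of u h] h by (simp flip: norm_square_self_adjoint)
    then show ?thesis using h by (auto simp: nonneg_element_def star_mult intro!: exI[of _ 1])
  qed
  \<comment> \<open>The summand 1 keeps the divisor positive when \<open>h = 0\<close>.\<close>
  define c where "c = norm h + 1"
  have c: "c > 0" "norm h \<le> c" by (auto simp: c_def add_nonneg_pos)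
  have "nonneg_element (c\<^sup>2 *\<^sub>R (((1/c) *\<^sub>R h) * ((1/c) *\<^sub>R h)))"
    using c assms by (intro nonneg_element_scaleR unit) (auto simp: star_scaleR divide_simps)
  then show ?thesis using c by (simp add: power2_eq_square)
qed

text \<open>This uses \<open>(1 + k)\<^sup>2 = (1 - k)\<^sup>2 + 4 k\<close>, a sum of two commuting squares.\<close>

lemma norm_one_add_nonneg:
  assumes k: "nonneg_element k" and "norm k = 1"
  shows "norm (1 + k) = 2"
proof -
  obtain h where h: "h * h = k" "nonneg_element h" using nonneg_element_square_root[OF k] by blast
  then have sh: "star h = h" by (simp add: nonneg_element_def)
  have nh: "norm h = 1"
    using norm_square_self_adjoint[OF sh] h assms norm_ge_zero[of h] by (simp add: power2_eq_1_iff)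
  have sk: "star k = k" using k by (simp add: nonneg_element_def)
  have kh: "k * h = h * k" using h by (metis mult.assoc)
  have "(2 *\<^sub>R h) * (2 *\<^sub>R h) + (1 - k) * (1 - k) = (1 + k) * (1 + k)"
  proof -
    have "4 *\<^sub>R k = (1 + 1 + 1 + 1) *\<^sub>R k" by simp
    then have "4 *\<^sub>R k = k + k + k + k" by (simp only: scaleR_add_left scaleR_one)
    then show ?thesis by (simp add: h(1) algebra_simps)
  qed
  moreover have "(norm (2 *\<^sub>R h))\<^sup>2 \<le> norm ((2 *\<^sub>R h) * (2 *\<^sub>R h) + (1 - k) * (1 - k))"
    by (rule norm_square_le_sum_squares) (simp_all add: star_scaleR sh star_diff sk kh algebra_simps)
  moreover have "norm ((1 + k) * (1 + k)) \<le> (norm (1 + k))\<^sup>2"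
    by (simp add: norm_mult_ineq power2_eq_square)
  ultimately have "2\<^sup>2 \<le> (norm (1 + k))\<^sup>2" by (simp add: nh)
  then have "2 \<le> norm (1 + k)" using norm_ge_zero power2_le_imp_le by blast
  then show ?thesis using norm_triangle_ineq[of 1 k] assms by simp
qed

text \<open>Repeated doubling yields the claim for \<open>norm k = 1\<close> and
  \<open>r = 2 ^ n - 1\<close>. A smaller \<open>r\<close> inherits it by the triangle inequality,
  since a loss at \<open>r\<close> would persist at every larger value; other norms of
  \<open>k\<close> follow by scaling.\<close>

lemma norm_add_nonneg:
  assumes k: "nonneg_element k" and r: "r \<ge> 0"
  shows "norm (r *\<^sub>R 1 + k) = r + norm k"
proof -
  have *: "norm ((2 ^ n - 1) *\<^sub>R 1 + k) = 2 ^ n" if "nonneg_element k" "norm k = 1" for n and k :: 'a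
    using that
  proof (induction n arbitrary: k)
    case (Suc n)
    \<comment> \<open>The average of 1 and \<open>k\<close> is again nonnegative of norm 1, so the
      induction hypothesis applies to it.\<close>
    let ?k = "(1/2) *\<^sub>R (1 + k)"
    have "nonneg_element ?k" "norm ?k = 1"
      using Suc.prems by (auto intro!: nonneg_element_scaleR nonneg_element_add simp: norm_one_add_nonneg)
    then have "norm ((2 ^ n - 1) *\<^sub>R 1 + ?k) = 2 ^ n" by (rule Suc.IH)
    moreover have "(2 ^ Suc n - 1) *\<^sub>R 1 + k = 2 *\<^sub>R ((2 ^ n - 1) *\<^sub>R 1 + ?k)"
      by (simp add: algebra_simps scaleR_2)
    ultimately show ?case by simp
  qed simp
  have unit: "norm (r *\<^sub>R 1 + k) = r + 1" if k: "nonneg_element k" "norm k = 1" and r: "r \<ge> 0"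
    for r and k :: 'a
  proof -
    obtain n where n: "r + 1 < 2 ^ n" using real_arch_pow[of 2 "r + 1"] by auto
    have "(2 ^ n - 1) *\<^sub>R 1 + k = (2 ^ n - 1 - r) *\<^sub>R 1 + (r *\<^sub>R 1 + k)" by (simp add: algebra_simps)
    then have "2 ^ n \<le> norm ((2 ^ n - 1 - r) *\<^sub>R (1::'a)) + norm (r *\<^sub>R 1 + k)"
      using *[OF k, of n] norm_triangle_ineq by metis
    then have "r + 1 \<le> norm (r *\<^sub>R 1 + k)" using n by simp
    moreover have "norm (r *\<^sub>R 1 + k) \<le> r + 1"
      using norm_triangle_ineq[of "r *\<^sub>R 1" k] r k by simp
    ultimately show ?thesis by simp
  qed
  show ?thesis
  proof (cases "k = 0")
    case False
    let ?c = "norm k"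
    have "norm ((r / ?c) *\<^sub>R 1 + (1 / ?c) *\<^sub>R k) = r / ?c + 1"
      using False k r by (intro unit nonneg_element_scaleR) auto
    moreover have "r *\<^sub>R 1 + k = ?c *\<^sub>R ((r / ?c) *\<^sub>R 1 + (1 / ?c) *\<^sub>R k)"
      using False by (simp add: algebra_simps)
    ultimately have "norm (r *\<^sub>R 1 + k) = ?c * (r / ?c + 1)" by (metis norm_scaleR abs_norm_cancel)
    also have "\<dots> = r + norm k" using False by (simp add: distrib_left)
    finally show ?thesis .
  qed (use r in simp)
qed

text \<open>Expand \<open>(t - c\<^sup>* c)\<^sup>2\<close> and move one factor \<open>c\<close> across: \<open>c (t - c\<^sup>* c) = (t - c c\<^sup>*) c\<close>, where
  \<open>c c\<^sup>*\<close> is nonnegative because \<open>c\<^sup>* c + c c\<^sup>*\<close> is a sum of two squares.\<close>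

lemma star_mult_self_eq_minus_square:
  fixes c d :: "'a::unital_cstar_algebra"
  assumes cd: "star c * c = - (d * d)" and d: "star d = d"
  shows "c = 0"
proof -
  define x y where "x = re_part c" and "y = im_part c"
  have xy: "star x = x" "star y = y" and c: "c = x + \<i> *\<^sub>C y"
    by (simp_all add: x_def y_def flip: re_im_part)
  have sc: "star c = x - \<i> *\<^sub>C y" using xy by (simp add: c star_add star_scaleC scaleC_minus_left)
  have "star c * c + c * star c = 2 *\<^sub>R (x * x) + 2 *\<^sub>R (y * y)"
    unfolding sc unfolding c
    by (simp add: algebra_simps mult_scaleC_left mult_scaleC_right scaleC_scaleC scaleC_minus_left
        scaleC_add_right scaleC_diff_right scaleR_2)
  then have e: "c * star c = 2 *\<^sub>R (x * x) + 2 *\<^sub>R (y * y) + d * d"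
    using cd by (simp add: algebra_simps)
  have "nonneg_element (c * star c)"
    unfolding e using xy d by (intro nonneg_element_add nonneg_element_scaleR nonneg_element_square) auto
  then obtain t where t: "t \<ge> 0" "norm (t *\<^sub>R 1 - c * star c) \<le> t"
    by (auto simp: nonneg_element_def)
  define \<gamma> where "\<gamma> = (norm c)\<^sup>2"
  have \<gamma>: "norm (star c * c) = \<gamma>" "norm (d * d) = \<gamma>"
    using arg_cong[OF cd, of norm] by (simp_all add: \<gamma>_def cstar_identity)
  let ?m = "t *\<^sub>R 1 - star c * c"
  have m: "?m = t *\<^sub>R 1 + d * d" by (simp add: cd)
  \<comment> \<open>The hypothesis makes \<open>?m\<close> the sum of \<open>t\<close> and the
    nonnegative \<open>d * d\<close>, so its norm is as large as possible. The expansion below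
    bounds the square of that norm by \<open>t * t + 2 * t * \<gamma>\<close>, which forces
    \<open>\<gamma> = 0\<close>.\<close>
  have "norm ?m = t + \<gamma>"
    unfolding m using norm_add_nonneg[OF nonneg_element_square[OF d] t(1)] \<gamma> by simp
  moreover have "star ?m = ?m" by (simp add: star_diff star_scaleR star_mult star_star)
  ultimately have "(t + \<gamma>)\<^sup>2 = norm (?m * ?m)" by (simp add: norm_square_self_adjoint)
  also have "?m * ?m = t *\<^sub>R t *\<^sub>R 1 - t *\<^sub>R (star c * c) - star c * (t *\<^sub>R 1 - c * star c) * c"
    by (simp add: algebra_simps)
  also have "norm \<dots> \<le> norm (t *\<^sub>R t *\<^sub>R (1::'a)) + norm (t *\<^sub>R (star c * c))
      + norm (star c * (t *\<^sub>R 1 - c * star c) * c)"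
    by (intro order_trans[OF norm_triangle_ineq4] add_mono order_refl)
  also have "norm (star c * (t *\<^sub>R 1 - c * star c) * c) \<le> norm c * t * norm c"
    using t by (intro order_trans[OF norm_mult_ineq] mult_mono) auto
  finally have "(t + \<gamma>)\<^sup>2 \<le> t * t + t * \<gamma> + \<gamma> * t"
    using t \<gamma> by (simp add: \<gamma>_def power2_eq_square mult.commute mult.left_commute)
  then have "\<gamma> * \<gamma> \<le> 0" by (simp add: power2_eq_square algebra_simps)
  then have "\<gamma> = 0" by (metis mult_eq_0_iff not_square_less_zero order_le_less)
  then show ?thesis by (simp add: \<gamma>_def)
qed

text \<open>With \<open>h = b\<^sup>* b\<close> and \<open>n = (\<bar>h\<bar> - h)/2\<close>, the element \<open>c = b n\<close> satisfies \<open>c\<^sup>* c = - n\<^sup>3\<close>.\<close>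

lemma nonneg_element_star_mult_self:
  fixes b :: "'a::unital_cstar_algebra"
  shows "nonneg_element (star b * b)"
proof -
  define h where "h = star b * b"
  have sh: "star h = h" by (simp add: h_def star_mult star_star)
  obtain r where r: "r * r = h * h" "nonneg_element r" and rc: "\<And>y. h * h * y = y * (h * h) \<Longrightarrow> r * y = y * r"
    using nonneg_element_square_root[OF nonneg_element_square[OF sh]] by metis
  \<comment> \<open>The root \<open>v\<close> of \<open>r\<close> exhibits
    \<open>n * n * n = n * r * n\<close> as the square of the self-adjoint element
    \<open>v * n\<close>.\<close>
  obtain v where v: "v * v = r" "nonneg_element v" and vc: "\<And>y. r * y = y * r \<Longrightarrow> v * y = y * v"
    using nonneg_element_square_root[OF r(2)] by metis
  have sr: "star r = r" and sv: "star v = v" using r v by (simp_all add: nonneg_element_def)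
  have rh: "r * h = h * r" by (intro rc) (simp add: mult.assoc)
  define n where "n = (1/2) *\<^sub>R (r - h)"
  have sn: "star n = n" by (simp add: n_def star_scaleR star_diff sr sh)
  have vn: "v * n = n * v" by (intro vc) (simp add: n_def algebra_simps rh)
  have hn: "h * n = - (r * n)" by (simp add: n_def algebra_simps rh r(1))
  have nn: "n * n = r * n" 
  proof -
    have "n * n = (1/2) *\<^sub>R (r * n - h * n)" by (simp add: n_def algebra_simps)
    then show ?thesis unfolding hn by (simp flip: scaleR_2)
  qed
  have "star (b * n) * (b * n) = n * (h * n)" by (simp add: star_mult sn h_def mult.assoc)
  also have "\<dots> = - (n * (n * n))" by (simp add: hn nn)
  finally have c: "star (b * n) * (b * n) = - (n * (n * n))" .
  have "(v * n) * (v * n) = (n * v) * (v * n)" by (simp only: vn)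
  also have "\<dots> = n * (v * v) * n" by (simp only: mult.assoc)
  also have "\<dots> = n * (n * n)" by (simp only: v(1) nn mult.assoc)
  finally have "star (b * n) * (b * n) = - ((v * n) * (v * n))" by (simp only: c)
  moreover have "star (v * n) = v * n" by (simp only: star_mult sn sv vn)
  ultimately have "b * n = 0" by (rule star_mult_self_eq_minus_square)
  then have "n * (n * n) = 0" using c by simp
  \<comment> \<open>One more factor \<open>n\<close> turns the cube into an iterated square, to
    which the C*-identity applies twice.\<close>
  then have "(n * n) * (n * n) = 0" by (simp add: mult.assoc)
  then have "((norm n)\<^sup>2)\<^sup>2 = 0" 
    using norm_square_self_adjoint[of "n * n"] sn by (simp add: star_mult norm_square_self_adjoint)
  then have "r = h" by (simp add: n_def)
  then show ?thesis using r(2) by (simp add: h_def)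
qed


section \<open>The Hahn-Banach theorem and states\<close>

definition sublinear :: "('a::real_vector \<Rightarrow> real) \<Rightarrow> bool"
  where "sublinear p \<longleftrightarrow> (\<forall>x y. p (x + y) \<le> p x + p y) \<and> (\<forall>r\<ge>0. \<forall>x. p (r *\<^sub>R x) = r * p x)"

lemma sublinearI:
  assumes "\<And>x y. p (x + y) \<le> p x + p y" "\<And>r x. r > 0 \<Longrightarrow> p (r *\<^sub>R x) \<le> r * p x" "p 0 = 0"
  shows "sublinear p"
proof -
  have "p (r *\<^sub>R x) = r * p x" if r: "r > 0" for r x
  proof (rule antisym[OF assms(2)[OF r]])
    have "p ((1/r) *\<^sub>R (r *\<^sub>R x)) \<le> (1/r) * p (r *\<^sub>R x)" using r by (intro assms(2)) simp
    then show "r * p x \<le> p (r *\<^sub>R x)" using r by (simp add: field_simps)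
  qed
  then have "p (r *\<^sub>R x) = r * p x" if "r \<ge> 0" for r x
    using that assms(3) by (cases "r = 0") auto
  then show ?thesis using assms(1) by (simp add: sublinear_def)
qed

lemma sublinear_zero: "sublinear p \<Longrightarrow> p 0 = 0"
  unfolding sublinear_def by (metis mult_zero_left order_refl scaleR_zero_left)

lemma sublinear_ge_minus:
  assumes "sublinear p"
  shows "- p (- x) \<le> p x"
proof -
  have "p (x + - x) \<le> p x + p (- x)" using assms unfolding sublinear_def by blast
  then show ?thesis using sublinear_zero[OF assms] by simp
qed

text \<open>The functional is the infimum over \<open>t \<ge> 0\<close> of
  \<open>p (x + t *\<^sub>R y) - t * p y\<close>, finite because each term is at least
  \<open>- p (- x)\<close>; \<open>t = 0\<close> and \<open>t = 1\<close> give the two bounds. It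
  serves to show that minimal functionals are additive and to prescribe the value of a minorant at
  \<open>y\<close>.\<close>

lemma sublinear_shift:
  fixes p :: "'a::real_vector \<Rightarrow> real"
  assumes p: "sublinear p"
  shows "\<exists>q. sublinear q \<and> (\<forall>x. q x \<le> p x) \<and> (\<forall>x. q x \<le> p (x + y) - p y)"
proof -
  have add: "p (u + v) \<le> p u + p v" for u v using p by (simp add: sublinear_def)
  have scale: "r \<ge> 0 \<Longrightarrow> p (r *\<^sub>R u) = r * p u" for r u using p by (simp add: sublinear_def)
  define F where "F x t = p (x + t *\<^sub>R y) - t * p y" for x t
  define q where "q x = (INF t\<in>{0..}. F x t)" for x
  have lower: "- p (- x) \<le> F x t" if "t \<ge> 0" for x t
    using add[of "x + t *\<^sub>R y" "- x"] scale[OF that, of y] by (simp add: F_def)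
  have bdd: "bdd_below (F x ` {0..})" for x
    by (rule bdd_belowI[of _ "- p (- x)"]) (use lower in auto)
  have le: "q x \<le> F x t" if "t \<ge> 0" for x t
    unfolding q_def using that by (intro cINF_lower[OF bdd]) auto
  have ge: "c \<le> q x" if "\<And>t. t \<ge> 0 \<Longrightarrow> c \<le> F x t" for c x
    unfolding q_def using that by (intro cINF_greatest) auto
  have "sublinear q"
  proof (rule sublinearI)
    fix x x'
    have *: "q (x + x') \<le> F x s + F x' t" if st: "s \<ge> 0" "t \<ge> 0" for s t
    proof -
      have "F (x + x') (s + t) \<le> F x s + F x' t"
        using add[of "x + s *\<^sub>R y" "x' + t *\<^sub>R y"] by (simp add: F_def algebra_simps)
      then show ?thesis using le[of "s + t" "x + x'"] st by linarith
    qed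
    have "q (x + x') - F x' t \<le> q x" if "t \<ge> 0" for t
      using *[OF _ that] by (intro ge) (simp add: algebra_simps)
    then have "q (x + x') - q x \<le> q x'" by (intro ge) (simp add: algebra_simps)
    then show "q (x + x') \<le> q x + q x'" by simp
  next
    fix r :: real and x assume r: "r > 0"
    have "(1/r) * q (r *\<^sub>R x) \<le> F x t" if t: "t \<ge> 0" for t
    proof -
      have "F (r *\<^sub>R x) (r * t) = r * F x t"
        using scale[of r "x + t *\<^sub>R y"] r by (simp add: F_def algebra_simps)
      then show ?thesis using le[of "r * t" "r *\<^sub>R x"] r t by (simp add: field_simps)
    qed
    then have "(1/r) * q (r *\<^sub>R x) \<le> q x" by (rule ge)
    then show "q (r *\<^sub>R x) \<le> r * q x" using r by (simp add: field_simps)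
  next
    have "F 0 t = 0" if "t \<ge> 0" for t using scale[OF that] by (simp add: F_def)
    then show "q 0 = 0" using le[of 0 0] ge[of 0 0] by (intro antisym) auto
  qed
  moreover have "q x \<le> p x" for x using le[of 0 x] by (simp add: F_def)
  moreover have "q x \<le> p (x + y) - p y" for x using le[of 1 x] by (simp add: F_def)
  ultimately show ?thesis by blast
qed

text \<open>Given \<open>q\<close> and \<open>r\<close> in the chain, the smaller one lies below
  both, which yields subadditivity of the infimum. The common bound \<open>p\<close> makes the
  infimum finite, since \<open>- p (- x) \<le> q x\<close>.\<close>

lemma sublinear_INF_chain:
  fixes C :: "('a::real_vector \<Rightarrow> real) set"
  assumes sub: "\<And>q. q \<in> C \<Longrightarrow> sublinear q" and bound: "\<And>q x. q \<in> C \<Longrightarrow> q x \<le> p x"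
    and chain: "\<And>q r. q \<in> C \<Longrightarrow> r \<in> C \<Longrightarrow> q \<le> r \<or> r \<le> q" and ne: "C \<noteq> {}"
  shows "sublinear (\<lambda>x. INF q\<in>C. q x)" and "\<And>q x. q \<in> C \<Longrightarrow> (INF q\<in>C. q x) \<le> q x"
proof -
  have bdd: "bdd_below ((\<lambda>q. q x) ` C)" for x
  proof (rule bdd_belowI2)
    fix q assume q: "q \<in> C"
    then show "- p (- x) \<le> q x" using sublinear_ge_minus[OF sub[OF q], of x] bound[OF q, of "- x"] by linarith
  qed
  show le: "(INF q\<in>C. q x) \<le> q x" if "q \<in> C" for q x
    using that by (intro cINF_lower[OF bdd])
  have ge: "c \<le> (INF q\<in>C. q x)" if "\<And>q. q \<in> C \<Longrightarrow> c \<le> q x" for c x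
    using that ne by (intro cINF_greatest)
  show "sublinear (\<lambda>x. INF q\<in>C. q x)"
  proof (rule sublinearI)
    fix x y
    have *: "(INF q\<in>C. q (x + y)) \<le> q x + r y" if qr: "q \<in> C" "r \<in> C" for q r
    proof -
      obtain m where m: "m \<in> C" "m x \<le> q x" "m y \<le> r y"
        using chain[OF qr] qr by (metis le_fun_def order_refl)
      have "m (x + y) \<le> m x + m y" using sub[OF m(1)] by (simp add: sublinear_def)
      then show ?thesis using le[OF m(1), of "x + y"] m by linarith
    qed
    have "(INF q\<in>C. q (x + y)) - r y \<le> (INF q\<in>C. q x)" if "r \<in> C" for r
      using *[OF _ that] by (intro ge) (simp add: algebra_simps)
    then have "(INF q\<in>C. q (x + y)) - (INF q\<in>C. q x) \<le> (INF q\<in>C. q y)"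
      by (intro ge) (simp add: algebra_simps)
    then show "(INF q\<in>C. q (x + y)) \<le> (INF q\<in>C. q x) + (INF q\<in>C. q y)" by simp
  next
    fix r :: real and x assume r: "r > 0"
    have "(1/r) * (INF q\<in>C. q (r *\<^sub>R x)) \<le> q x" if q: "q \<in> C" for q
    proof -
      have "q (r *\<^sub>R x) = r * q x" using sub[OF q] r by (simp add: sublinear_def)
      then show ?thesis using le[OF q, of "r *\<^sub>R x"] r by (simp add: field_simps)
    qed
    then have "(1/r) * (INF q\<in>C. q (r *\<^sub>R x)) \<le> (INF q\<in>C. q x)" by (rule ge)
    then show "(INF q\<in>C. q (r *\<^sub>R x)) \<le> r * (INF q\<in>C. q x)" using r by (simp add: field_simps)
  next
    have "q 0 = 0" if "q \<in> C" for q using sub that sublinear_zero by blast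
    then have "(\<lambda>q. q 0) ` C = {0}" using ne by force
    then show "(INF q\<in>C. q 0) = 0" by simp
  qed
qed

text \<open>A minimal sublinear functional is linear, by minimality against its shifts.\<close>

lemma sublinear_linear_minorant:
  fixes p :: "'a::real_vector \<Rightarrow> real"
  assumes p: "sublinear p"
  shows "\<exists>f. linear f \<and> (\<forall>x. f x \<le> p x)"
proof -
  define A where "A = {q. sublinear q \<and> (\<forall>x. q x \<le> p x)}"
  have "\<exists>m\<in>A. \<forall>q\<in>A. q \<le> m \<longrightarrow> q = m"
  proof (rule predicate_Zorn)
    \<comment> \<open>The order is reversed, so upper bounds for Zorn's lemma are lower bounds of
      chains and the element obtained is minimal.\<close>
    show "partial_order_on A (relation_of (\<lambda>x y. y \<le> x) A)"
      by (rule partial_order_on_relation_ofI) auto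
  next
    fix C assume C: "C \<in> Chains (relation_of (\<lambda>x y. y \<le> x) A)"
    then have CA: "C \<subseteq> A" and ch: "\<And>q r. q \<in> C \<Longrightarrow> r \<in> C \<Longrightarrow> q \<le> r \<or> r \<le> q"
      by (auto simp: Chains_def relation_of_def)
    show "\<exists>u\<in>A. \<forall>a\<in>C. u \<le> a"
    proof (cases "C = {}")
      case True
      then show ?thesis using p by (auto simp: A_def)
    next
      case False
      let ?u = "\<lambda>x. INF q\<in>C. q x"
      have sub: "sublinear q" and bound: "q x \<le> p x" if "q \<in> C" for q x
        using that CA by (auto simp: A_def)
      have u: "sublinear ?u" "\<And>q x. q \<in> C \<Longrightarrow> ?u x \<le> q x"
        by (rule sublinear_INF_chain[of C p]; use sub bound ch False in blast)+
      obtain q where "q \<in> C" using False by blast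
      then have "?u x \<le> p x" for x using u(2) bound order_trans by blast
      then have "?u \<in> A" using u(1) by (simp add: A_def)
      moreover have "\<forall>a\<in>C. ?u \<le> a" using u(2) by (auto simp: le_fun_def)
      ultimately show ?thesis by blast
    qed
  qed
  then obtain m where m: "sublinear m" "\<And>x. m x \<le> p x"
    and min: "\<And>q. q \<in> A \<Longrightarrow> q \<le> m \<Longrightarrow> q = m" by (auto simp: A_def)
  have add: "m (x + y) = m x + m y" for x y
  proof -
    obtain q where q: "sublinear q" "\<And>x. q x \<le> m x" "\<And>x. q x \<le> m (x + y) - m y"
      using sublinear_shift[OF m(1)] by blast
    have "q \<in> A" "q \<le> m" using q(1,2) m(2) order_trans by (auto simp: A_def le_fun_def) blast
    then have "q = m" by (rule min)
    then have "m x + m y \<le> m (x + y)" using q(3)[of x] by simp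
    moreover have "m (x + y) \<le> m x + m y" using m(1) by (simp add: sublinear_def)
    ultimately show ?thesis by simp
  qed
  have scale: "r \<ge> 0 \<Longrightarrow> m (r *\<^sub>R x) = r * m x" for r x using m(1) by (simp add: sublinear_def)
  have minus: "m (- x) = - m x" for x using add[of x "- x"] sublinear_zero[OF m(1)] by simp
  have "linear m"
  proof (rule linearI)
    fix r :: real and x
    show "m (r *\<^sub>R x) = r *\<^sub>R m x"
      using scale[of r x] scale[of "- r" x] minus[of "r *\<^sub>R x"] by (cases "r \<ge> 0") auto
  qed (rule add)
  then show ?thesis using m(2) by blast
qed

text \<open>A linear functional below the shift \<open>q\<close> of \<open>p\<close> at
  \<open>y\<close> satisfies \<open>f (- y) \<le> q (- y) \<le> p 0 - p y\<close>, hence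
  \<open>f y \<ge> p y\<close>.\<close>

lemma sublinear_linear_minorant_at:
  fixes p :: "'a::real_vector \<Rightarrow> real"
  assumes p: "sublinear p"
  shows "\<exists>f. linear f \<and> (\<forall>x. f x \<le> p x) \<and> f y = p y"
proof -
  obtain q where q: "sublinear q" "\<And>x. q x \<le> p x" "\<And>x. q x \<le> p (x + y) - p y"
    using sublinear_shift[OF p] by blast
  obtain f where f: "linear f" "\<And>x. f x \<le> q x" using sublinear_linear_minorant[OF q(1)] by blast
  have "f (- y) \<le> - p y" using f(2)[of "- y"] q(3)[of "- y"] sublinear_zero[OF p] by simp
  then have "p y \<le> f y" using linear_neg[OF f(1), of y] by simp
  then show ?thesis using f q(2) by (meson antisym order_trans)
qed

lemma sublinear_norm: "sublinear (norm :: 'a::real_normed_vector \<Rightarrow> real)"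
  by (simp add: sublinear_def norm_triangle_ineq)

section \<open>States and their control of the norm\<close>

text \<open>Positivity only mentions the real part because the hermitian clause makes the value at
  \<open>star b * b\<close> real. Every clause is a closed condition on finitely many values of
  \<open>g\<close>, so the states form a closed set for pointwise convergence.\<close>

definition cstar_state :: "('a::unital_cstar_algebra \<Rightarrow> complex) \<Rightarrow> bool"
  where "cstar_state g \<longleftrightarrow>
    (\<forall>a b. g (a + b) = g a + g b) \<and> (\<forall>c a. g (c *\<^sub>C a) = c * g a) \<and> g 1 = 1 \<and>
    (\<forall>a. g (star a) = cnj (g a)) \<and> (\<forall>b. 0 \<le> Re (g (star b * b)))"

text \<open>A functional of norm 1 that attains its norm at \<open>1 + k\<close>, where
  \<open>k = \<parallel>h\<parallel> + h \<ge> 0\<close> and hence \<open>\<parallel>1 + k\<parallel> = 1 + \<parallel>k\<parallel>\<close>, attains it both at \<open>1\<close> and at \<open>k\<close>.\<close>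

lemma cstar_state_exists:
  fixes h :: "'a::unital_cstar_algebra"
  assumes h: "star h = h"
  shows "\<exists>g. cstar_state g \<and> g h = complex_of_real (norm (norm h *\<^sub>R 1 + h) - norm h)"
proof -
  define k where "k = norm h *\<^sub>R 1 + h"
  have k: "nonneg_element k" using nonneg_element_norm_add[OF h] by (simp add: k_def)
  obtain f :: "'a \<Rightarrow> real" where f: "linear f" "\<And>x. f x \<le> norm x" "f (1 + k) = norm (1 + k)"
    using sublinear_linear_minorant_at[OF sublinear_norm, of "1 + k"] by blast
  have "norm (1 + k) = 1 + norm k" using norm_add_nonneg[OF k, of 1] by simp
  then have f1: "f 1 = 1" and fk: "f k = norm k"
    using f(2)[of 1] f(2)[of k] f(3) linear_add[OF f(1), of 1 k] by auto
  \<comment> \<open>From \<open>norm (t *\<^sub>R 1 - star b * b) \<le> t\<close>,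
    \<open>f \<le> norm\<close> and \<open>f 1 = 1\<close> it follows that
    \<open>t - f (star b * b) \<le> t\<close>.\<close>
  have pos: "0 \<le> f (star b * b)" for b
  proof -
    obtain t where t: "t \<ge> 0" "norm (t *\<^sub>R 1 - star b * b) \<le> t"
      using nonneg_element_star_mult_self[of b] by (auto simp: nonneg_element_def)
    have "f (t *\<^sub>R 1 - star b * b) = t - f (star b * b)"
      using f1 by (simp add: linear_diff[OF f(1)] linear_scale[OF f(1)])
    then show ?thesis using f(2)[of "t *\<^sub>R 1 - star b * b"] t by linarith
  qed
  \<comment> \<open>The real-linear \<open>f\<close> is used only on self-adjoint elements and
    extended complex-linearly from there, which makes \<open>g\<close> hermitian.\<close>
  define g where "g a = Complex (f (re_part a)) (f (im_part a))" for a
  have re_add: "re_part (a + b) = re_part a + re_part b"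
    and im_add: "im_part (a + b) = im_part a + im_part b" for a b :: 'a
    by (simp_all add: re_part_def im_part_def star_add algebra_simps scaleC_add_right scaleC_diff_right)
  have sa: "re_part x = x" "im_part x = 0" if "star x = x" for x :: 'a
    using that by (simp_all add: re_part_def im_part_def flip: scaleR_2)
  have re_scale: "re_part (c *\<^sub>C a) = Re c *\<^sub>R re_part a - Im c *\<^sub>R im_part a"
    and im_scale: "im_part (c *\<^sub>C a) = Re c *\<^sub>R im_part a + Im c *\<^sub>R re_part a" for c and a :: 'a
  proof -
    have c: "c = complex_of_real (Re c) + \<i> * complex_of_real (Im c)" by (simp add: complex_eq)
    have cc: "cnj c = complex_of_real (Re c) - \<i> * complex_of_real (Im c)" by (simp add: complex_eq_iff)
    show "re_part (c *\<^sub>C a) = Re c *\<^sub>R re_part a - Im c *\<^sub>R im_part a"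
      unfolding re_part_def im_part_def scaleR_scaleC star_scaleC cc
      by (subst (1) c) (simp add: scaleC_add_left scaleC_diff_left scaleC_add_right scaleC_diff_right
          scaleC_scaleC scaleC_minus_left algebra_simps)
    show "im_part (c *\<^sub>C a) = Re c *\<^sub>R im_part a + Im c *\<^sub>R re_part a"
      unfolding re_part_def im_part_def scaleR_scaleC star_scaleC cc
      by (subst (1) c) (simp add: scaleC_add_left scaleC_diff_left scaleC_add_right scaleC_diff_right
        scaleC_scaleC scaleC_minus_left algebra_simps)
  qed
  have re_star: "re_part (star a) = re_part a" and im_star: "im_part (star a) = - im_part a" for a :: 'a
    by (simp_all add: re_part_def im_part_def star_star add.commute scaleC_minus_left scaleC_diff_right)
  have "cstar_state g"
    unfolding cstar_state_def
  proof (intro conjI allI)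
    show "g (a + b) = g a + g b" for a b
      by (simp add: g_def re_add im_add linear_add[OF f(1)] complex_eq_iff)
    show "g (c *\<^sub>C a) = c * g a" for c a
      by (simp add: g_def re_scale im_scale linear_add[OF f(1)] linear_diff[OF f(1)]
          linear_scale[OF f(1)] complex_eq_iff)
    show "g 1 = 1" using f1 by (simp add: g_def sa linear_0[OF f(1)] complex_eq_iff)
    show "g (star a) = cnj (g a)" for a
      by (simp add: g_def re_star im_star linear_neg[OF f(1)] complex_eq_iff)
    show "0 \<le> Re (g (star b * b))" for b
      using pos by (simp add: g_def sa star_mult star_star)
  qed
  moreover have "f h = norm k - norm h"
    using fk f1 by (simp add: k_def linear_add[OF f(1)] linear_scale[OF f(1)])
  then have "g h = complex_of_real (norm k - norm h)"
    by (simp add: g_def sa h linear_0[OF f(1)] complex_eq_iff)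
  ultimately show ?thesis unfolding k_def by blast
qed

text \<open>With \<open>l = norm h\<close>, suitable states show that \<open>l + h\<close> and
  \<open>l - h\<close> have norm at most \<open>l + e\<close>. The difference of their squares is
  \<open>4 * l * h\<close>, of norm \<open>4 * l\<^sup>2\<close>, so
  \<open>2 * l\<^sup>2 \<le> (l + e)\<^sup>2\<close>.\<close>

lemma norm_self_adjoint_le_states:
  fixes h :: "'a::unital_cstar_algebra"
  assumes h: "star h = h" and bound: "\<And>g. cstar_state g \<Longrightarrow> cmod (g h) \<le> e"
  shows "norm h \<le> 3 * e"
proof -
  define l where "l = norm h"
  have *: "norm (l *\<^sub>R 1 + k) \<le> l + e"
    if k: "star k = k" "norm k = l" "\<And>g. cstar_state g \<Longrightarrow> cmod (g k) \<le> e" for k :: 'a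
  proof -
    obtain g where g: "cstar_state g" "g k = complex_of_real (norm (norm k *\<^sub>R 1 + k) - norm k)"
      using cstar_state_exists[OF k(1)] by blast
    have "cmod (g k) = \<bar>norm (norm k *\<^sub>R 1 + k) - norm k\<bar>" unfolding g(2) by (rule norm_of_real)
    then show ?thesis using k(3)[OF g(1)] k(2) by simp
  qed
  have neg: "g (- h) = - g h" if "cstar_state g" for g
    using that unfolding cstar_state_def by (metis mult_minus1 scaleC_minus_left scaleC_one)
  have p: "norm (l *\<^sub>R 1 + h) \<le> l + e" using h bound by (intro *) (simp_all add: l_def)
  have m: "norm (l *\<^sub>R 1 - h) \<le> l + e"
    using *[of "- h"] h bound by (simp add: l_def star_minus neg)
  have "(l *\<^sub>R 1 + h) * (l *\<^sub>R 1 + h) - (l *\<^sub>R 1 - h) * (l *\<^sub>R 1 - h) = (1 + 1 + 1 + 1) *\<^sub>R (l *\<^sub>R h)"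
    unfolding scaleR_add_left scaleR_one by (simp add: algebra_simps)
  then have "4 * l\<^sup>2 = norm ((l *\<^sub>R 1 + h) * (l *\<^sub>R 1 + h) - (l *\<^sub>R 1 - h) * (l *\<^sub>R 1 - h))"
    by (simp add: l_def power2_eq_square)
  also have "\<dots> \<le> norm (l *\<^sub>R 1 + h) * norm (l *\<^sub>R 1 + h) + norm (l *\<^sub>R 1 - h) * norm (l *\<^sub>R 1 - h)"
    by (intro order_trans[OF norm_triangle_ineq4] add_mono norm_mult_ineq)
  also have "\<dots> \<le> (l + e) * (l + e) + (l + e) * (l + e)"
    using p m order_trans[OF norm_ge_zero p] by (intro add_mono mult_mono) auto
  finally have sq: "2 * l\<^sup>2 \<le> (l + e)\<^sup>2" by (simp add: power2_eq_square)
  show ?thesis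
  proof (rule ccontr)
    assume "\<not> norm h \<le> 3 * e"
    \<comment> \<open>The constant 3 suffices because
      \<open>(4/3)\<^sup>2 = 16/9 < 2\<close>.\<close>
    then have "3 * (l + e) < 4 * l" by (simp add: l_def)
    moreover have "0 \<le> l + e" using order_trans[OF norm_ge_zero p] .
    ultimately have "(3 * (l + e))\<^sup>2 < (4 * l)\<^sup>2" by (intro power_strict_mono) auto
    then have "9 * (l + e)\<^sup>2 < 16 * l\<^sup>2" unfolding power_mult_distrib by simp
    then have "2 * l\<^sup>2 < 0" using sq by linarith
    then show False using zero_le_power2[of l] by linarith
  qed
qed

lemma norm_le_states:
  fixes a :: "'a::unital_cstar_algebra"
  assumes bound: "\<And>g. cstar_state g \<Longrightarrow> cmod (g a) \<le> e"
  shows "norm a \<le> 6 * e"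
proof -
  have parts: "g (re_part a) = complex_of_real (Re (g a))" "g (im_part a) = complex_of_real (Im (g a))"
    if g: "cstar_state g" for g
  proof -
    have ga: "g a = g (re_part a) + \<i> * g (im_part a)"
      using g unfolding cstar_state_def by (metis re_im_part)
    have "Im (g h) = 0" if "star h = h" for h
      using g that unfolding cstar_state_def by (metis Reals_cnj_iff complex_is_Real_iff)
    then show "g (re_part a) = complex_of_real (Re (g a))" "g (im_part a) = complex_of_real (Im (g a))"
      using ga by (simp_all add: complex_eq_iff)
  qed
  have "norm (re_part a) \<le> 3 * e" "norm (im_part a) \<le> 3 * e"
  proof -
    have "cmod (g (re_part a)) \<le> e" if "cstar_state g" for g
      using parts(1)[OF that] abs_Re_le_cmod[of "g a"] bound[OF that] by simp
    then show "norm (re_part a) \<le> 3 * e" by (intro norm_self_adjoint_le_states) simp_all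
    have "cmod (g (im_part a)) \<le> e" if "cstar_state g" for g
      using parts(2)[OF that] abs_Im_le_cmod[of "g a"] bound[OF that] by simp
    then show "norm (im_part a) \<le> 3 * e" by (intro norm_self_adjoint_le_states) simp_all
  qed
  moreover have "norm a \<le> norm (re_part a) + norm (im_part a)"
    using norm_triangle_ineq[of "re_part a" "\<i> *\<^sub>C im_part a"] re_im_part[of a] by (simp add: norm_scaleC)
  ultimately show ?thesis by linarith
qed


section \<open>Matrix states\<close>

text \<open>This isolates how the quadratic form depends on the coordinate \<open>z\<close> at the
  new index \<open>p\<close>, so that \<open>z\<close> can be chosen freely when the form is reduced
  to \<open>I\<close>.\<close>

lemma sesquilinear_sum_insert:
  fixes m :: "'i \<Rightarrow> 'i \<Rightarrow> complex"
  assumes "finite I" "p \<notin> I" and herm: "\<And>i j. i \<in> insert p I \<Longrightarrow> j \<in> insert p I \<Longrightarrow> m j i = cnj (m i j)"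
  defines "w c \<equiv> \<Sum>j\<in>I. m p j * c j"
  shows "(\<Sum>i\<in>insert p I. \<Sum>j\<in>insert p I. cnj ((c(p := z)) i) * (c(p := z)) j * m i j) =
    cnj z * z * m p p + cnj z * w c + z * cnj (w c) + (\<Sum>i\<in>I. \<Sum>j\<in>I. cnj (c i) * c j * m i j)"
proof -
  have upd: "(c(p := z)) i = c i" if "i \<in> I" for i using that assms(2) by auto
  have "(\<Sum>i\<in>insert p I. \<Sum>j\<in>insert p I. cnj ((c(p := z)) i) * (c(p := z)) j * m i j) =
      cnj z * z * m p p + (\<Sum>j\<in>I. cnj z * c j * m p j) +
      (\<Sum>i\<in>I. cnj (c i) * z * m i p + (\<Sum>j\<in>I. cnj (c i) * c j * m i j))"
    using assms(1,2) by (simp add: upd fun_upd_same del: fun_upd_apply cong: sum.cong)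
  also have "(\<Sum>j\<in>I. cnj z * c j * m p j) = cnj z * w c"
    by (simp add: w_def sum_distrib_left mult_ac)
  also have "(\<Sum>i\<in>I. cnj (c i) * z * m i p + (\<Sum>j\<in>I. cnj (c i) * c j * m i j)) =
      (\<Sum>i\<in>I. cnj (c i) * z * m i p) + (\<Sum>i\<in>I. \<Sum>j\<in>I. cnj (c i) * c j * m i j)"
    by (rule sum.distrib)
  also have "(\<Sum>i\<in>I. cnj (c i) * z * m i p) = (\<Sum>i\<in>I. z * cnj (m p i * c i))"
  proof (rule sum.cong)
    fix i assume "i \<in> I"
    then have "m i p = cnj (m p i)" using herm[of p i] by simp
    then show "cnj (c i) * z * m i p = z * cnj (m p i * c i)" by simp
  qed simp
  also have "\<dots> = z * cnj (w c)" by (simp add: w_def sum_distrib_left)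
  finally show ?thesis by (simp add: add.assoc)
qed

text \<open>Cholesky factorisation, one Schur complement at a time. When the pivot \<open>m p p\<close> vanishes, so does
  its row, and division by zero makes the formulas below correct in that case too.\<close>

lemma positive_semidefinite_imp_matrix_positive:
  fixes m :: "'i \<Rightarrow> 'i \<Rightarrow> complex"
  assumes "finite I"
    and "\<And>i j. i \<in> I \<Longrightarrow> j \<in> I \<Longrightarrow> m j i = cnj (m i j)"
    and "\<And>c. 0 \<le> Re (\<Sum>i\<in>I. \<Sum>j\<in>I. cnj (c i) * c j * m i j)"
  shows "matrix_positive I m"
  using assms
proof (induction I arbitrary: m rule: finite_induct)
  case empty
  then show ?case by (simp add: matrix_positive_def)
next
  case (insert p I)
  note herm = insert.prems(1)
  define w where "w c = (\<Sum>j\<in>I. m p j * c j)" for c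
  define Q where "Q c = (\<Sum>i\<in>I. \<Sum>j\<in>I. cnj (c i) * c j * m i j)" for c
  define d where "d = Re (m p p)"
  have mpp: "m p p = complex_of_real d"
    using herm[of p p] by (simp add: d_def complex_eq_iff)
  have form: "0 \<le> Re (cnj z * z * m p p + cnj z * w c + z * cnj (w c) + Q c)" for z c
  proof -
    have "(\<Sum>i\<in>insert p I. \<Sum>j\<in>insert p I. cnj ((c(p := z)) i) * (c(p := z)) j * m i j) =
        cnj z * z * m p p + cnj z * w c + z * cnj (w c) + Q c"
      unfolding w_def Q_def by (rule sesquilinear_sum_insert[OF insert.hyps(1,2) herm])
    then show ?thesis using insert.prems(2)[of "c(p := z)"] by (simp only:)
  qed
  have d0: "d \<ge> 0" using form[of 1 "\<lambda>_. 0"] by (simp add: mpp w_def Q_def)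
  have row: "m p j = 0" if "d = 0" "j \<in> I" for j
  proof (rule ccontr)
    assume ne: "m p j \<noteq> 0"
    define c where "c = (\<lambda>i. if i = j then 1 else 0 :: complex)"
    have wc: "w c = m p j" using that insert.hyps by (simp add: w_def c_def if_distrib cong: if_cong)
    \<comment> \<open>The size of \<open>s\<close> makes the form negative at
      \<open>z = - s * m p j\<close>: its quadratic term in \<open>z\<close> vanishes with the pivot
      and the linear terms contribute \<open>- 2 * (\<bar>Re (Q c)\<bar> + 1)\<close>.\<close>
    define s where "s = (\<bar>Re (Q c)\<bar> + 1) / (cmod (m p j))\<^sup>2"
    have "0 \<le> Re (Q c) - 2 * (s * (cmod (m p j))\<^sup>2)"
      using form[of "- complex_of_real s * m p j" c] that
      unfolding cmod_power2 by (simp add: wc mpp power2_eq_square algebra_simps)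
    also have "s * (cmod (m p j))\<^sup>2 = \<bar>Re (Q c)\<bar> + 1" using ne by (simp add: s_def)
    finally show False by simp
  qed
  define m' where "m' i j = m i j - cnj (m p i) * m p j / d" for i j
  have "matrix_positive I m'"
  proof (rule insert.IH)
    show "m' j i = cnj (m' i j)" if "i \<in> I" "j \<in> I" for i j
      using herm[of i j] that by (simp add: m'_def mult.commute)
    show "0 \<le> Re (\<Sum>i\<in>I. \<Sum>j\<in>I. cnj (c i) * c j * m' i j)" for c
    proof -
      have "(\<Sum>i\<in>I. \<Sum>j\<in>I. cnj (c i) * c j * m' i j) =
          Q c - (\<Sum>i\<in>I. \<Sum>j\<in>I. cnj (m p i * c i) * (m p j * c j)) / d"
        by (simp add: m'_def Q_def sum_subtractf right_diff_distrib sum_divide_distrib mult_ac)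
      also have "(\<Sum>i\<in>I. \<Sum>j\<in>I. cnj (m p i * c i) * (m p j * c j)) = cnj (w c) * w c"
        unfolding w_def cnj_sum sum_product ..
      finally have *: "(\<Sum>i\<in>I. \<Sum>j\<in>I. cnj (c i) * c j * m' i j) = Q c - cnj (w c) * w c / d" .
      show ?thesis
      proof (cases "d = 0")
        case True
        then show ?thesis using form[of 0 c] by (simp add: *)
      next
        case False
        \<comment> \<open>The value \<open>z = - w c / d\<close> minimises the form in
          \<open>z\<close> and leaves the form of the Schur complement.\<close>
        have "cnj (- w c / d) * (- w c / d) * m p p + cnj (- w c / d) * w c + (- w c / d) * cnj (w c) + Q c
            = Q c - cnj (w c) * w c / d"
          using False by (simp add: mpp field_simps)
        then show ?thesis using form[of "- w c / d" c] unfolding * by simp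
      qed
    qed
  qed
  then obtain \<beta> where \<beta>: "\<And>i j. i \<in> I \<Longrightarrow> j \<in> I \<Longrightarrow> m' i j = (\<Sum>k\<in>I. cnj (\<beta> k i) * \<beta> k j)"
    unfolding matrix_positive_def star_complex_def by blast
  \<comment> \<open>Row \<open>p\<close> of the factor is row \<open>p\<close> of \<open>m\<close>
    over the root of the pivot; the other rows factor the Schur complement, with 0 in column
    \<open>p\<close>.\<close>
  define b where "b k j = (if k = p then m p j / complex_of_real (sqrt d) else if j = p then 0 else \<beta> k j)" for k j
  have b_sum: "(\<Sum>k\<in>insert p I. cnj (b k i) * b k j) =
      cnj (m p i) * m p j / d + (\<Sum>k\<in>I. cnj (b k i) * b k j)" for i j
  proof -
    have "complex_of_real (sqrt d) * complex_of_real (sqrt d) = d"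
      using d0 by (simp flip: of_real_mult)
    then show ?thesis using insert.hyps by (simp add: b_def)
  qed
  have b_p: "(\<Sum>k\<in>I. cnj (b k i) * b k j) = 0" if "i = p \<or> j = p" for i j
    using that insert.hyps by (intro sum.neutral) (auto simp: b_def)
  have b_I: "(\<Sum>k\<in>I. cnj (b k i) * b k j) = m' i j" if "i \<in> I" "j \<in> I" for i j
    using that insert.hyps \<beta>[OF that] by (auto simp: b_def intro!: sum.cong)
  have mp: "cnj (m p p) * m p j / d = m p j" if "j \<in> insert p I" for j
    using that row by (cases "d = 0") (auto simp: mpp)
  have "m i j = (\<Sum>k\<in>insert p I. star (b k i) * b k j)" if ij: "i \<in> insert p I" "j \<in> insert p I" for i j
    unfolding star_complex_def b_sum
  proof (cases "i = p \<or> j = p")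
    case True
    have "cnj (m p i) * m p j / d = m i j"
    proof (cases "i = p")
      case True
      then show ?thesis using mp ij by simp
    next
      case False
      then have j: "j = p" using True by simp
      have "cnj (m p i) * m p p / d = cnj (cnj (m p p) * m p i / d)" by simp
      also have "\<dots> = m i p" using mp[OF ij(1)] herm[OF _ ij(1), of p] by simp
      finally show ?thesis unfolding j .
    qed
    then show "m i j = cnj (m p i) * m p j / d + (\<Sum>k\<in>I. cnj (b k i) * b k j)"
      using b_p[OF True] by simp
  next
    case False
    then show "m i j = cnj (m p i) * m p j / d + (\<Sum>k\<in>I. cnj (b k i) * b k j)"
      using b_I[of i j] ij by (simp add: m'_def)
  qed
  then show ?case unfolding matrix_positive_def by blast
qed

section \<open>States as matrix states of size 1\<close>

lemma cstar_state_sum: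
  assumes "cstar_state g"
  shows "g (\<Sum>i\<in>I. f i) = (\<Sum>i\<in>I. g (f i))"
proof -
  have "g 0 = 0" using assms unfolding cstar_state_def by (metis mult_zero_left scaleC_zero_left)
  then show ?thesis
    using assms by (induction I rule: infinite_finite_induct) (simp_all add: cstar_state_def)
qed

lemma star_sum: "star (\<Sum>i\<in>I. f i) = (\<Sum>i\<in>I. star (f i :: 'a::unital_cstar_algebra))"
  by (induction I rule: infinite_finite_induct) (simp_all add: star_add)

text \<open>Complete positivity is automatic for scalar values: if \<open>a\<close> factors through
  \<open>b\<close>, the quadratic form of \<open>[g (a k l)]\<close> at \<open>c\<close> is the sum
  of the values of \<open>g\<close> at \<open>star (y m) * y m\<close>, where \<open>y m\<close>
  combines row \<open>m\<close> of \<open>b\<close> with coefficients \<open>c\<close>.\<close>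

lemma cstar_state_in_matrix_states:
  assumes g: "cstar_state g"
  shows "(\<lambda>a i j. if i = 0 \<and> j = 0 then g a else 0) \<in> matrix_states 1"
proof -
  have add: "g (a + b) = g a + g b" and scale: "g (c *\<^sub>C a) = c * g a" and one: "g 1 = 1"
    and herm: "g (star a) = cnj (g a)" and pos: "0 \<le> Re (g (star b * b))" for a b c
    using g by (simp_all add: cstar_state_def)
  have "matrix_positive ({..<1} \<times> {..<r}) (pairing (\<lambda>a i j. if i = 0 \<and> j = 0 then g a else 0) a)"
    if pos_a: "matrix_positive {..<r} a" for r a
  proof -
    obtain b where "\<forall>k\<in>{..<r}. \<forall>l\<in>{..<r}. a k l = (\<Sum>m<r. star (b m k) * b m l)"
      using pos_a unfolding matrix_positive_def by blast
    then have b: "\<And>k l. k < r \<Longrightarrow> l < r \<Longrightarrow> a k l = (\<Sum>m<r. star (b m k) * b m l)" by simp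
    show ?thesis
    proof (rule positive_semidefinite_imp_matrix_positive)
      fix p q assume "p \<in> {..<1::nat} \<times> {..<r}" "q \<in> {..<1::nat} \<times> {..<r}"
      then obtain k l where kl: "p = (0, k)" "q = (0, l)" "k < r" "l < r" by auto
      have "star (a k l) = a l k" using kl by (simp add: b star_sum star_mult star_star)
      then show "pairing (\<lambda>a i j. if i = 0 \<and> j = 0 then g a else 0) a q p =
          cnj (pairing (\<lambda>a i j. if i = 0 \<and> j = 0 then g a else 0) a p q)"
        by (simp add: kl pairing_def flip: herm)
    next
      fix c :: "nat \<times> nat \<Rightarrow> complex"
      have prod: "{..<1::nat} \<times> {..<r} = Pair 0 ` {..<r}" by auto
      define y where "y m = (\<Sum>k<r. c (0, k) *\<^sub>C b m k)" for m
      have "(\<Sum>m<r. g (star (y m) * y m)) =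
          (\<Sum>m<r. \<Sum>k<r. \<Sum>l<r. cnj (c (0, k)) * c (0, l) * g (star (b m k) * b m l))"
        unfolding y_def star_sum star_scaleC sum_product cstar_state_sum[OF g]
        by (simp add: mult_scaleC_left mult_scaleC_right scale mult_ac)
      also have "\<dots> = (\<Sum>k<r. \<Sum>m<r. \<Sum>l<r. cnj (c (0, k)) * c (0, l) * g (star (b m k) * b m l))"
        by (rule sum.swap)
      also have "\<dots> = (\<Sum>k<r. \<Sum>l<r. \<Sum>m<r. cnj (c (0, k)) * c (0, l) * g (star (b m k) * b m l))"
        by (rule sum.cong[OF refl]) (rule sum.swap)
      also have "\<dots> = (\<Sum>k<r. \<Sum>l<r. cnj (c (0, k)) * c (0, l) * g (a k l))"
        by (intro sum.cong refl) (simp add: b cstar_state_sum[OF g] sum_distrib_left)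
      finally have "(\<Sum>k<r. \<Sum>l<r. cnj (c (0, k)) * c (0, l) * g (a k l)) = (\<Sum>m<r. g (star (y m) * y m))" ..
      then have "0 \<le> Re (\<Sum>k<r. \<Sum>l<r. cnj (c (0, k)) * c (0, l) * g (a k l))"
        using pos by (simp add: Re_sum sum_nonneg)
      then show "0 \<le> Re (\<Sum>p\<in>{..<1} \<times> {..<r}. \<Sum>q\<in>{..<1} \<times> {..<r}. cnj (c p) * c q *
          pairing (\<lambda>a i j. if i = 0 \<and> j = 0 then g a else 0) a p q)"
        unfolding prod by (simp add: sum.reindex inj_on_def pairing_def)
    qed simp
  qed
  then show ?thesis
    unfolding matrix_states_def by (auto simp: add scale one)
qed

section \<open>Entrywise bounds for positive matrices and matrix states\<close>

text \<open>Each summand \<open>cnj (b k p) * b k q\<close> is estimated by the arithmetic-geometric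
  mean inequality.\<close>

lemma matrix_positive_entry_le:
  fixes m :: "'i \<Rightarrow> 'i \<Rightarrow> complex"
  assumes "matrix_positive I m" "p \<in> I" "q \<in> I"
  shows "cmod (m p q) \<le> (Re (m p p) + Re (m q q)) / 2"
proof -
  obtain b where b: "\<And>i j. i \<in> I \<Longrightarrow> j \<in> I \<Longrightarrow> m i j = (\<Sum>k\<in>I. cnj (b k i) * b k j)"
    using assms(1) unfolding matrix_positive_def star_complex_def by blast
  have "cmod (m p q) \<le> (\<Sum>k\<in>I. cmod (cnj (b k p) * b k q))"
    using assms(2,3) by (simp only: b norm_sum)
  also have "\<dots> \<le> (\<Sum>k\<in>I. (Re (cnj (b k p) * b k p) + Re (cnj (b k q) * b k q)) / 2)"
  proof (rule sum_mono)
    fix k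
    have "Re (cnj z * z) = (cmod z)\<^sup>2" for z
      unfolding cmod_power2 by (simp add: power2_eq_square)
    moreover have "2 * (cmod (b k p) * cmod (b k q)) \<le> (cmod (b k p))\<^sup>2 + (cmod (b k q))\<^sup>2"
      using sum_squares_bound[of "cmod (b k p)" "cmod (b k q)"] by simp
    ultimately show "cmod (cnj (b k p) * b k q) \<le> (Re (cnj (b k p) * b k p) + Re (cnj (b k q) * b k q)) / 2"
      by (simp only: norm_mult complex_mod_cnj) simp
  qed
  also have "\<dots> = (Re (m p p) + Re (m q q)) / 2"
    using assms(2,3) by (simp add: b Re_sum sum.distrib flip: sum_divide_distrib)
  finally show ?thesis .
qed

context
  fixes n :: nat and \<phi> :: "'a::unital_cstar_algebra \<Rightarrow> nat \<Rightarrow> nat \<Rightarrow> complex"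
  assumes \<phi>: "\<phi> \<in> matrix_states n"
begin

lemma matrix_state_add: "\<phi> (a + b) i j = \<phi> a i j + \<phi> b i j"
  and matrix_state_scaleC: "\<phi> (c *\<^sub>C a) i j = c * \<phi> a i j"
  and matrix_state_outside: "\<not> (i < n \<and> j < n) \<Longrightarrow> \<phi> a i j = 0"
  and matrix_state_one: "i < n \<Longrightarrow> j < n \<Longrightarrow> \<phi> 1 i j = (if i = j then 1 else 0)"
  using \<phi> by (simp_all add: matrix_states_def)

lemma matrix_state_zero: "\<phi> 0 i j = 0"
  using matrix_state_scaleC[of 0 0 i j] by simp

lemma matrix_state_minus: "\<phi> (- a) i j = - \<phi> a i j"
  using matrix_state_scaleC[of "- 1" a i j] by (simp add: scaleC_minus_left)

lemma matrix_state_diff: "\<phi> (a - b) i j = \<phi> a i j - \<phi> b i j"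
  using matrix_state_add[of a "- b" i j] by (simp add: matrix_state_minus)

lemma matrix_state_scaleR: "\<phi> (r *\<^sub>R a) i j = complex_of_real r * \<phi> a i j"
  by (simp add: scaleR_scaleC matrix_state_scaleC)

lemma matrix_state_sum: "\<phi> (\<Sum>k\<in>I. f k) i j = (\<Sum>k\<in>I. \<phi> (f k) i j)"
  by (induction I rule: infinite_finite_induct) (simp_all add: matrix_state_zero matrix_state_add)

text \<open>Both \<open>1 - h\<close> and \<open>1 + h\<close> have the form
  \<open>star s * s\<close>, so each entry is bounded by the mean of two diagonal entries. When the
  two bounds are added, the diagonal values of \<open>h\<close> cancel.\<close>

lemma matrix_state_unit_bound:
  assumes h: "star h = h" "norm h \<le> 1" and ij: "i < n" "j < n"
  shows "cmod (\<phi> h i j) \<le> 1"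
proof -
  have *: "cmod (\<phi> (1 - k) i j) \<le> 1 - (Re (\<phi> k i i) + Re (\<phi> k j j)) / 2"
    if k: "star k = k" "norm k \<le> 1" for k
  proof -
    obtain s where s: "star s * s = 1 - k" using square_root_one_minus[OF k(2,1)] by metis
    have "matrix_positive {..<1::nat} (\<lambda>_ _. 1 - k)"
      unfolding matrix_positive_def using s by (intro exI[of _ "\<lambda>_ _. s"]) simp
    then have "matrix_positive ({..<n} \<times> {..<1}) (pairing \<phi> (\<lambda>_ _. 1 - k))"
      using \<phi> unfolding matrix_states_def by blast
    from matrix_positive_entry_le[OF this, of "(i, 0)" "(j, 0)"] ij
    show ?thesis by (simp add: pairing_def matrix_state_diff matrix_state_one field_simps)
  qed
  have "2 * \<phi> h i j = \<phi> (1 - (- h)) i j - \<phi> (1 - h) i j"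
    by (simp add: matrix_state_add matrix_state_diff)
  then have "2 * cmod (\<phi> h i j) \<le> cmod (\<phi> (1 - (- h)) i j) + cmod (\<phi> (1 - h) i j)"
    by (metis norm_mult norm_numeral norm_triangle_ineq4)
  then show ?thesis
    using *[of h] *[of "- h"] h by (simp add: star_minus matrix_state_minus field_simps)
qed

text \<open>Self-adjoint elements are scaled to norm 1 and satisfy the bound with constant 1; the
  factor 2 comes from adding real and imaginary parts.\<close>

lemma matrix_state_bound: "cmod (\<phi> a i j) \<le> 2 * norm a"
proof (cases "i < n \<and> j < n")
  case ij: True
  have sa: "cmod (\<phi> h i j) \<le> norm h" if h: "star h = h" for h
  proof (cases "h = 0")
    case False
    then have "cmod (\<phi> ((1 / norm h) *\<^sub>R h) i j) \<le> 1"
      using h ij by (intro matrix_state_unit_bound) (simp_all add: star_scaleR)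
    then show ?thesis using False by (simp add: matrix_state_scaleR norm_mult norm_divide field_simps)
  qed (simp add: matrix_state_zero)
  have "\<phi> a i j = \<phi> (re_part a) i j + \<i> * \<phi> (im_part a) i j"
    by (metis re_im_part matrix_state_add matrix_state_scaleC)
  then have "cmod (\<phi> a i j) \<le> cmod (\<phi> (re_part a) i j) + cmod (\<phi> (im_part a) i j)"
    by (metis norm_ii norm_mult mult_1 norm_triangle_ineq)
  also have "\<dots> \<le> norm (re_part a) + norm (im_part a)" by (intro add_mono sa) simp_all
  finally show ?thesis using norm_re_part_le[of a] norm_im_part_le[of a] by linarith
qed (simp add: matrix_state_outside)

end

lemma cstar_state_bound: "cstar_state g \<Longrightarrow> cmod (g a) \<le> 2 * norm a"
  using matrix_state_bound[OF cstar_state_in_matrix_states, where a = a and i = 0 and j = 0] by simp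


section \<open>Norms of matrices and the matrix metric\<close>

context
  fixes I :: "'i set" and X :: "'i \<Rightarrow> 'i \<Rightarrow> 'h::real_normed_vector \<Rightarrow> 'h"
  assumes fin: "finite I" and lin: "\<And>i j. i \<in> I \<Longrightarrow> j \<in> I \<Longrightarrow> bounded_linear (X i j)"
begin

lemma op_matrix_norm_upper:
  fixes x :: "'i \<Rightarrow> 'h"
  assumes "L2_set (\<lambda>j. norm (x j)) I \<le> 1"
  shows "L2_set (\<lambda>i. norm (\<Sum>j\<in>I. X i j (x j))) I \<le> op_matrix_norm I X"
  unfolding op_matrix_norm_def
proof (rule cSUP_upper)
  show "x \<in> {x. L2_set (\<lambda>j. norm (x j)) I \<le> 1}" using assms by simp
  show "bdd_above ((\<lambda>x. L2_set (\<lambda>i. norm (\<Sum>j\<in>I. X i j (x j))) I) ` {x. L2_set (\<lambda>j. norm (x j)) I \<le> 1})"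
  proof (rule bdd_aboveI2)
    fix x :: "'i \<Rightarrow> 'h" assume "x \<in> {x. L2_set (\<lambda>j. norm (x j)) I \<le> 1}"
    then have x: "norm (x j) \<le> 1" if "j \<in> I" for j
      using member_le_L2_set[OF fin that, of "\<lambda>j. norm (x j)"] by simp
    have "L2_set (\<lambda>i. norm (\<Sum>j\<in>I. X i j (x j))) I \<le> (\<Sum>i\<in>I. norm (\<Sum>j\<in>I. X i j (x j)))"
      by (rule L2_set_le_sum) simp
    also have "\<dots> \<le> (\<Sum>i\<in>I. \<Sum>j\<in>I. onorm (X i j))"
    proof (intro sum_mono order_trans[OF norm_sum])
      fix i j assume ij: "i \<in> I" "j \<in> I"
      have "norm (X i j (x j)) \<le> onorm (X i j) * norm (x j)" using onorm[OF lin[OF ij]] .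
      also have "\<dots> \<le> onorm (X i j) * 1"
        using x[OF ij(2)] onorm_pos_le[OF lin[OF ij]] by (intro mult_left_mono) auto
      finally show "norm (X i j (x j)) \<le> onorm (X i j)" by simp
    qed
    finally show "L2_set (\<lambda>i. norm (\<Sum>j\<in>I. X i j (x j))) I \<le> (\<Sum>i\<in>I. \<Sum>j\<in>I. onorm (X i j))" .
  qed
qed

lemma op_matrix_norm_bound:
  "L2_set (\<lambda>i. norm (\<Sum>j\<in>I. X i j (x j))) I \<le> op_matrix_norm I X * L2_set (\<lambda>j. norm (x j)) I"
proof (cases "L2_set (\<lambda>j. norm (x j)) I = 0")
  case True
  then have x0: "x j = 0" if "j \<in> I" for j using that fin by (simp add: L2_set_eq_0_iff)
  have "(\<Sum>j\<in>I. X i j (x j)) = 0" if "i \<in> I" for i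
    using that lin x0 by (intro sum.neutral) (auto simp: bounded_linear.linear linear_0)
  then have "L2_set (\<lambda>i. norm (\<Sum>j\<in>I. X i j (x j))) I = 0" by (intro L2_set_0') auto
  then show ?thesis using True by simp
next
  case False
  define s where "s = L2_set (\<lambda>j. norm (x j)) I"
  have s: "s > 0" using False by (simp add: s_def order_less_le)
  have scale: "L2_set (\<lambda>j. (1/s) * norm (f j)) I = (1/s) * L2_set (\<lambda>j. norm (f j)) I" for f :: "'i \<Rightarrow> 'h"
    using L2_set_right_distrib[of "1/s" "\<lambda>j. norm (f j)" I] s by simp
  have "L2_set (\<lambda>i. norm (\<Sum>j\<in>I. X i j ((1/s) *\<^sub>R x j))) I \<le> op_matrix_norm I X"
    using s scale[of x] by (intro op_matrix_norm_upper) (simp flip: s_def)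
  also have "L2_set (\<lambda>i. norm (\<Sum>j\<in>I. X i j ((1/s) *\<^sub>R x j))) I
      = L2_set (\<lambda>i. (1/s) * norm (\<Sum>j\<in>I. X i j (x j))) I"
  proof (rule L2_set_cong[OF refl])
    fix i assume i: "i \<in> I"
    have "(\<Sum>j\<in>I. X i j ((1/s) *\<^sub>R x j)) = (1/s) *\<^sub>R (\<Sum>j\<in>I. X i j (x j))"
      unfolding scaleR_sum_right
      using lin i by (intro sum.cong refl) (simp add: bounded_linear.linear linear_scale)
    then show "norm (\<Sum>j\<in>I. X i j ((1/s) *\<^sub>R x j)) = (1/s) * norm (\<Sum>j\<in>I. X i j (x j))"
      using s by simp
  qed
  finally show ?thesis using s unfolding scale s_def[symmetric] by (simp add: field_simps)
qed

end

lemma op_matrix_norm_least: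
  assumes "\<And>x. L2_set (\<lambda>j. norm (x j)) I \<le> 1 \<Longrightarrow> L2_set (\<lambda>i. norm (\<Sum>j\<in>I. X i j (x j))) I \<le> c"
  shows "op_matrix_norm I X \<le> c"
  unfolding op_matrix_norm_def
proof (rule cSUP_least)
  have "(\<lambda>_. 0) \<in> {x. L2_set (\<lambda>j. norm (x j)) I \<le> 1}" by (simp add: L2_set_def)
  then show "{x. L2_set (\<lambda>j. norm (x j)) I \<le> 1} \<noteq> {}" by (metis empty_iff)
qed (use assms in simp)

lemma complex_matrix_norm_entry:
  assumes "finite I" "p \<in> I" "q \<in> I"
  shows "cmod (m p q) \<le> complex_matrix_norm I m"
proof -
  define x where "x = (\<lambda>j. if j = q then 1 else 0 :: complex)"
  have "(\<Sum>j\<in>I. (norm (x j))\<^sup>2) = (\<Sum>j\<in>I. if j = q then 1 else 0)"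
    by (intro sum.cong) (auto simp: x_def)
  then have "L2_set (\<lambda>j. norm (x j)) I \<le> 1"
    using assms by (simp add: L2_set_def)
  then have "L2_set (\<lambda>i. norm (\<Sum>j\<in>I. m i j * x j)) I \<le> complex_matrix_norm I m"
    unfolding complex_matrix_norm_def
    by (intro op_matrix_norm_upper assms bounded_linear_mult_right)
  moreover have "norm (\<Sum>j\<in>I. m p j * x j) \<le> L2_set (\<lambda>i. norm (\<Sum>j\<in>I. m i j * x j)) I"
    by (rule member_le_L2_set[OF assms(1,2)])
  moreover have "(\<Sum>j\<in>I. m p j * x j) = m p q"
    using assms by (simp add: x_def if_distrib cong: if_cong)
  ultimately show ?thesis by simp
qed

lemma L2_set_norm_sum_le:
  "L2_set (\<lambda>k. norm (\<Sum>j\<in>J. f j k)) K \<le> (\<Sum>j\<in>J. L2_set (\<lambda>k. norm (f j k)) K)"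
proof (induction J rule: infinite_finite_induct)
  case (insert j J)
  have "L2_set (\<lambda>k. norm (\<Sum>j\<in>insert j J. f j k)) K
      \<le> L2_set (\<lambda>k. norm (f j k) + norm (\<Sum>j\<in>J. f j k)) K"
    using insert.hyps by (intro L2_set_mono) (auto simp: norm_triangle_ineq)
  also have "\<dots> \<le> L2_set (\<lambda>k. norm (f j k)) K + L2_set (\<lambda>k. norm (\<Sum>j\<in>J. f j k)) K"
    by (rule L2_set_triangle_ineq)
  finally show ?case using insert by simp
qed (simp_all add: L2_set_def)

lemma L2_set_Times:
  "finite A \<Longrightarrow> finite B \<Longrightarrow> L2_set f (A \<times> B) = L2_set (\<lambda>i. L2_set (\<lambda>k. f (i, k)) B) A"
  by (simp add: L2_set_def sum.cartesian_product sum_nonneg)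

text \<open>The norm of a block matrix is at most the sum of the norms of its blocks, and the norm of a block
  is a supremum over pairs of unit vectors.\<close>

lemma complex_matrix_norm_block_le:
  fixes m :: "nat \<times> nat \<Rightarrow> nat \<times> nat \<Rightarrow> complex"
  assumes d: "d \<ge> 0" and block: "\<And>i j u v. i < n \<Longrightarrow> j < n \<Longrightarrow>
      L2_set (\<lambda>k. cmod (u k)) {..<r} \<le> 1 \<Longrightarrow> L2_set (\<lambda>l. cmod (v l)) {..<r} \<le> 1 \<Longrightarrow>
      cmod (\<Sum>k<r. \<Sum>l<r. u k * v l * m (i, k) (j, l)) \<le> d"
  shows "complex_matrix_norm ({..<n} \<times> {..<r}) m \<le> real n * (real n * d)"
  unfolding complex_matrix_norm_def
proof (rule op_matrix_norm_least)
  fix x :: "nat \<times> nat \<Rightarrow> complex"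
  assume x: "L2_set (\<lambda>q. norm (x q)) ({..<n} \<times> {..<r}) \<le> 1"
  define y where "y i j k = (\<Sum>l<r. m (i, k) (j, l) * x (j, l))" for i j k
  have y: "L2_set (\<lambda>k. cmod (y i j k)) {..<r} \<le> d" if ij: "i < n" "j < n" for i j
  proof (cases "L2_set (\<lambda>k. cmod (y i j k)) {..<r} = 0")
    case False
    define s where "s = L2_set (\<lambda>k. cmod (y i j k)) {..<r}"
    have s: "s > 0" using False by (simp add: s_def order_less_le)
    \<comment> \<open>The normalised conjugate of the vector \<open>y i j\<close> is the unit vector
      whose pairing with it returns its norm \<open>s\<close>.\<close>
    define u where "u k = cnj (y i j k) / s" for k
    have "L2_set (\<lambda>k. cmod (u k)) {..<r} = L2_set (\<lambda>k. (1/s) * cmod (y i j k)) {..<r}"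
      using s by (intro L2_set_cong) (auto simp: u_def norm_divide)
    also have "\<dots> = (1/s) * s"
      unfolding s_def by (rule L2_set_right_distrib[symmetric]) simp
    also have "\<dots> = 1" using s by simp
    finally have u: "L2_set (\<lambda>k. cmod (u k)) {..<r} \<le> 1" by simp
    have "L2_set (\<lambda>l. cmod (x (j, l))) {..<r} \<le> L2_set (\<lambda>j. L2_set (\<lambda>l. cmod (x (j, l))) {..<r}) {..<n}"
      using ij by (intro member_le_L2_set) auto
    then have v: "L2_set (\<lambda>l. cmod (x (j, l))) {..<r} \<le> 1" using x by (simp add: L2_set_Times)
    have "(\<Sum>k<r. \<Sum>l<r. u k * x (j, l) * m (i, k) (j, l)) = (\<Sum>k<r. u k * y i j k)"
      by (simp add: y_def sum_distrib_left mult_ac)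
    also have "\<dots> = (\<Sum>k<r. complex_of_real ((cmod (y i j k))\<^sup>2)) / s"
      unfolding sum_divide_distrib
      by (intro sum.cong refl) (unfold complex_norm_square u_def, simp)
    also have "\<dots> = complex_of_real ((\<Sum>k<r. (cmod (y i j k))\<^sup>2) / s)" by simp
    also have "(\<Sum>k<r. (cmod (y i j k))\<^sup>2) = s\<^sup>2" by (simp add: s_def L2_set_def sum_nonneg)
    also have "s\<^sup>2 / s = s" using s by (simp add: power2_eq_square)
    finally have "cmod (complex_of_real s) \<le> d" using block[OF ij u v] by simp
    then show ?thesis using s by (simp add: s_def)
  qed (use d in simp)
  have "L2_set (\<lambda>p. norm (\<Sum>q\<in>{..<n} \<times> {..<r}. m p q * x q)) ({..<n} \<times> {..<r})
      = L2_set (\<lambda>i. L2_set (\<lambda>k. norm (\<Sum>j<n. y i j k)) {..<r}) {..<n}"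
    by (simp add: L2_set_Times y_def sum.cartesian_product)
  also have "\<dots> \<le> (\<Sum>i<n. L2_set (\<lambda>k. norm (\<Sum>j<n. y i j k)) {..<r})"
    by (rule L2_set_le_sum) simp
  also have "\<dots> \<le> (\<Sum>i<n. \<Sum>j<n. L2_set (\<lambda>k. norm (y i j k)) {..<r})"
    by (intro sum_mono L2_set_norm_sum_le)
  also have "\<dots> \<le> (\<Sum>i<n. \<Sum>j<n. d)" using y by (intro sum_mono) auto
  finally show "L2_set (\<lambda>p. norm (\<Sum>q\<in>{..<n} \<times> {..<r}. m p q * x q)) ({..<n} \<times> {..<r})
      \<le> real n * (real n * d)" by simp
qed

section \<open>Commutators as bounded operators\<close>

text \<open>The class relates the norm directly only to real scalars, so complex homogeneity is
  obtained by moving \<open>c\<close> out of both arguments of \<open>cinner\<close>.\<close>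

lemma norm_scaleC_hilbert: "norm (c *\<^sub>C x) = cmod c * norm (x::'h::complex_hilbert_space)"
proof -
  have "complex_of_real ((norm (c *\<^sub>C x))\<^sup>2) = c * cinner x (c *\<^sub>C x)"
    unfolding cinner_self[symmetric] by (rule cinner_scaleC_left)
  also have "\<dots> = c * cnj (cinner (c *\<^sub>C x) x)"
    by (subst cinner_commute) simp
  also have "\<dots> = c * cnj c * cnj (cinner x x)" by (simp add: cinner_scaleC_left)
  also have "\<dots> = complex_of_real ((cmod c * norm x)\<^sup>2)"
    unfolding power_mult_distrib of_real_mult cinner_self complex_norm_square[of c] by simp
  finally have "(norm (c *\<^sub>C x))\<^sup>2 = (cmod c * norm x)\<^sup>2" using of_real_eq_iff by blast
  then show ?thesis by (simp add: power2_eq_iff_nonneg)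
qed

text \<open>Continuous maps that agree on the dense set \<open>comm_dom \<pi> V a\<close> are equal;
  this justifies the definite description in \<open>commutator\<close>.\<close>

lemma extends_comm_unique:
  assumes "closure (comm_dom \<pi> V a) = UNIV" "extends_comm \<pi> V D a X" "extends_comm \<pi> V D a Y"
  shows "X = Y"
proof -
  have "continuous_on UNIV (\<lambda>x. X x - Y x)"
    using assms(2,3) unfolding extends_comm_def bounded_clinear_def
    by (intro continuous_intros linear_continuous_on) auto
  then have cont: "continuous_on (closure (comm_dom \<pi> V a)) (\<lambda>x. X x - Y x)"
    using continuous_on_subset by blast
  have "\<forall>x\<in>comm_dom \<pi> V a. X x - Y x = 0"
    using assms(2,3) unfolding extends_comm_def by simp
  then have "\<forall>x\<in>closure (comm_dom \<pi> V a). X x - Y x = 0"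
    using continuous_constant_on_closure[OF cont] by blast
  then show ?thesis using assms(1) by auto
qed

lemma bounded_clinear_commutator:
  assumes "a \<in> lipschitz_elements \<pi> V D"
  shows "bounded_clinear (commutator \<pi> V D a)"
proof -
  obtain X where X: "extends_comm \<pi> V D a X" and dense: "closure (comm_dom \<pi> V a) = UNIV"
    using assms by (auto simp: lipschitz_elements_def)
  have "extends_comm \<pi> V D a (commutator \<pi> V D a)"
    unfolding commutator_def
    by (rule theI[of "extends_comm \<pi> V D a", OF X extends_comm_unique[OF dense _ X]])
  then show ?thesis by (simp add: extends_comm_def)
qed

lemma bounded_linear_commutator:
  "a \<in> lipschitz_elements \<pi> V D \<Longrightarrow> bounded_linear (commutator \<pi> V D a)"
  using bounded_clinear_commutator[of a \<pi> V D] by (simp add: bounded_clinear_def)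

section \<open>The Lipschitz ball, its compressions and the matrix metric\<close>

locale fredholm_module =
  fixes \<pi> :: "'a::unital_cstar_algebra \<Rightarrow> 'h::complex_hilbert_space \<Rightarrow> 'h"
    and V :: "'h set" and D :: "'h \<Rightarrow> 'h"
  assumes module: "unbounded_fredholm_module \<pi> V D"
    and linear: "commutator_linear \<pi> V D"
begin

abbreviation lip where "lip \<equiv> lipschitz_elements \<pi> V D"
abbreviation lball where "lball \<equiv> lipschitz_ball \<pi> V D"
abbreviation comm where "comm \<equiv> commutator \<pi> V D"

lemma lip_scaleC: "a \<in> lip \<Longrightarrow> c *\<^sub>C a \<in> lip"
  and comm_scaleC: "a \<in> lip \<Longrightarrow> comm (c *\<^sub>C a) = (\<lambda>x. c *\<^sub>C comm a x)"
  and lip_add: "a \<in> lip \<Longrightarrow> b \<in> lip \<Longrightarrow> a + b \<in> lip"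
  and comm_add: "a \<in> lip \<Longrightarrow> b \<in> lip \<Longrightarrow> comm (a + b) = (\<lambda>x. comm a x + comm b x)"
  using linear by (simp_all add: commutator_linear_def)

lemma dense_lip: "closure lip = UNIV"
  using module by (simp add: unbounded_fredholm_module_def)

lemma zero_in_lip: "0 \<in> lip" and comm_zero: "comm 0 = (\<lambda>_. 0)"
proof -
  obtain a where "a \<in> lip" using dense_lip closure_empty by (metis UNIV_not_empty ex_in_conv)
  then show "0 \<in> lip" "comm 0 = (\<lambda>_. 0)" using lip_scaleC[of a 0] comm_scaleC[of a 0] by simp_all
qed

lemma lip_sum: "(\<And>i. i \<in> I \<Longrightarrow> f i \<in> lip) \<Longrightarrow> sum f I \<in> lip"
  by (induction I rule: infinite_finite_induct) (simp_all add: zero_in_lip lip_add)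

lemma comm_sum: "(\<And>i. i \<in> I \<Longrightarrow> f i \<in> lip) \<Longrightarrow> comm (sum f I) = (\<lambda>x. \<Sum>i\<in>I. comm (f i) x)"
  by (induction I rule: infinite_finite_induct) (simp_all add: comm_zero comm_add lip_sum)

lemma lipschitz_ball_bound: "a \<in> lball \<Longrightarrow> norm (comm a x) \<le> norm x"
  using order_trans[OF onorm[OF bounded_linear_commutator] mult_right_mono[of _ 1]]
  by (fastforce simp: lipschitz_ball_def)

lemma lipschitz_ballI:
  assumes "a \<in> lip" "\<And>x. norm (comm a x) \<le> norm x"
  shows "a \<in> lball"
  using assms by (simp add: lipschitz_ball_def) (rule onorm_bound; simp)

lemma scaled_in_lipschitz_ball:
  assumes "a \<in> lip"
  obtains t where "t > 0" "complex_of_real t *\<^sub>C a \<in> lball"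
proof
  \<comment> \<open>The summand 1 covers a vanishing commutator.\<close>
  define t where "t = 1 / (onorm (comm a) + 1)"
  have pos: "onorm (comm a) + 1 > 0"
    using onorm_pos_le[OF bounded_linear_commutator[OF assms]] by simp
  then show t: "t > 0" by (simp add: t_def)
  show "complex_of_real t *\<^sub>C a \<in> lball"
  proof (rule lipschitz_ballI)
    fix x
    have "norm (comm (complex_of_real t *\<^sub>C a) x) = t * norm (comm a x)"
      using t by (simp add: comm_scaleC assms norm_scaleC_hilbert)
    also have "\<dots> \<le> t * ((onorm (comm a) + 1) * norm x)"
      using onorm[OF bounded_linear_commutator[OF assms], of x] t
      by (intro mult_left_mono) (auto simp: algebra_simps intro: order_trans)
    also have "\<dots> = norm x" using pos by (simp add: t_def)
    finally show "norm (comm (complex_of_real t *\<^sub>C a) x) \<le> norm x" .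
  qed (use assms lip_scaleC in blast)
qed

lemma compression_in_lipschitz_ball:
  assumes a: "a \<in> lipschitz_matrix_ball \<pi> V D r"
    and u: "L2_set (\<lambda>k. cmod (u k)) {..<r} \<le> 1" and v: "L2_set (\<lambda>l. cmod (v l)) {..<r} \<le> 1"
  shows "(\<Sum>k<r. \<Sum>l<r. (u k * v l) *\<^sub>C a k l) \<in> lball"
proof (rule lipschitz_ballI)
  have lip: "a k l \<in> lip" if "k < r" "l < r" for k l
    using a that by (simp add: lipschitz_matrix_ball_def)
  show "(\<Sum>k<r. \<Sum>l<r. (u k * v l) *\<^sub>C a k l) \<in> lip"
    by (intro lip_sum lip_scaleC lip) auto
  fix x
  \<comment> \<open>This is the image of the vector with entries \<open>v l *\<^sub>C x\<close>
    under the matrix of commutators; pairing it with \<open>u\<close> is then controlled by the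
    Cauchy-Schwarz inequality.\<close>
  define y where "y k = (\<Sum>l<r. comm (a k l) (v l *\<^sub>C x))" for k
  have "comm (\<Sum>k<r. \<Sum>l<r. (u k * v l) *\<^sub>C a k l) x = (\<Sum>k<r. \<Sum>l<r. (u k * v l) *\<^sub>C comm (a k l) x)"
  proof -
    have "comm (\<Sum>k<r. \<Sum>l<r. (u k * v l) *\<^sub>C a k l) x = (\<Sum>k<r. comm (\<Sum>l<r. (u k * v l) *\<^sub>C a k l) x)"
      by (subst comm_sum) (auto intro!: lip_sum lip_scaleC lip)
    also have "\<dots> = (\<Sum>k<r. \<Sum>l<r. comm ((u k * v l) *\<^sub>C a k l) x)"
      by (intro sum.cong refl) (subst comm_sum, auto intro!: lip_scaleC lip)
    finally show ?thesis by (simp add: comm_scaleC lip)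
  qed
  also have "\<dots> = (\<Sum>k<r. u k *\<^sub>C y k)"
    using bounded_clinear_commutator[OF lip]
    by (simp add: y_def scaleC_sum_right bounded_clinear_def scaleC_scaleC)
  finally have "norm (comm (\<Sum>k<r. \<Sum>l<r. (u k * v l) *\<^sub>C a k l) x) \<le> (\<Sum>k<r. \<bar>cmod (u k)\<bar> * \<bar>norm (y k)\<bar>)"
    using norm_sum[of "\<lambda>k. u k *\<^sub>C y k" "{..<r}"] by (simp add: norm_scaleC_hilbert)
  also have "\<dots> \<le> L2_set (\<lambda>k. cmod (u k)) {..<r} * L2_set (\<lambda>k. norm (y k)) {..<r}"
    by (rule L2_set_mult_ineq)
  also have "\<dots> \<le> 1 * L2_set (\<lambda>k. norm (y k)) {..<r}"
    using u by (intro mult_right_mono) auto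
  also have "L2_set (\<lambda>k. norm (y k)) {..<r} \<le>
      op_matrix_norm {..<r} (\<lambda>i j. comm (a i j)) * L2_set (\<lambda>l. norm (v l *\<^sub>C x)) {..<r}"
    unfolding y_def using lip by (intro op_matrix_norm_bound bounded_linear_commutator) auto
  also have "\<dots> \<le> 1 * L2_set (\<lambda>l. norm (v l *\<^sub>C x)) {..<r}"
    using a by (intro mult_right_mono) (auto simp: lipschitz_matrix_ball_def)
  also have "L2_set (\<lambda>l. norm (v l *\<^sub>C x)) {..<r} = L2_set (\<lambda>l. cmod (v l)) {..<r} * norm x"
    by (simp add: norm_scaleC_hilbert L2_set_left_distrib)
  also have "1 * (\<dots>) \<le> 1 * norm x" using v by (simp add: mult_left_le_one_le)
  finally show "norm (comm (\<Sum>k<r. \<Sum>l<r. (u k * v l) *\<^sub>C a k l) x) \<le> norm x" by simp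
qed

lemma lipschitz_ball_in_matrix_ball:
  assumes "a \<in> lball"
  shows "(\<lambda>_ _. a) \<in> lipschitz_matrix_ball \<pi> V D 1"
proof -
  have "op_matrix_norm {..<1::nat} (\<lambda>i j. comm a) \<le> 1"
  proof (rule op_matrix_norm_least)
    fix x :: "nat \<Rightarrow> 'h" assume "L2_set (\<lambda>j. norm (x j)) {..<1} \<le> 1"
    then have "norm (x 0) \<le> 1" by (simp add: lessThan_Suc)
    then have "norm (comm a (x 0)) \<le> 1" using lipschitz_ball_bound[OF assms, of "x 0"] by linarith
    then show "L2_set (\<lambda>i. norm (\<Sum>j<1. comm a (x j))) {..<1::nat} \<le> 1" by (simp add: lessThan_Suc)
  qed
  then show ?thesis using assms by (simp add: lipschitz_matrix_ball_def lipschitz_ball_def)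
qed

text \<open>The matrices with \<open>r = 1\<close> in the supremum already suffice.\<close>

lemma matrix_metric_ge:
  assumes "a \<in> lball" "i < n" "j < n"
  shows "ennreal (cmod (\<phi> a i j - \<psi> a i j)) \<le> matrix_metric \<pi> V D n \<phi> \<psi>"
proof -
  let ?a = "\<lambda>_ _ :: nat. a"
  have "cmod (pairing \<phi> ?a (i, 0) (j, 0) - pairing \<psi> ?a (i, 0) (j, 0)) \<le>
      complex_matrix_norm ({..<n} \<times> {..<1}) (\<lambda>p q. pairing \<phi> ?a p q - pairing \<psi> ?a p q)"
    using assms by (intro complex_matrix_norm_entry) auto
  then have "ennreal (cmod (\<phi> a i j - \<psi> a i j)) \<le>
      ennreal (complex_matrix_norm ({..<n} \<times> {..<1}) (\<lambda>p q. pairing \<phi> ?a p q - pairing \<psi> ?a p q))"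
    by (intro ennreal_leI) (simp add: pairing_def)
  also have "\<dots> \<le> matrix_metric \<pi> V D n \<phi> \<psi>"
    unfolding matrix_metric_def
    by (rule SUP_upper2[where i = 1], simp,
        rule SUP_upper[where i = ?a], rule lipschitz_ball_in_matrix_ball[OF assms(1)])
  finally show ?thesis .
qed

lemma matrix_metric_le:
  assumes \<phi>: "\<phi> \<in> matrix_states n" and \<psi>: "\<psi> \<in> matrix_states n" and d: "d \<ge> 0"
    and le: "\<And>a i j. a \<in> lball \<Longrightarrow> i < n \<Longrightarrow> j < n \<Longrightarrow> cmod (\<phi> a i j - \<psi> a i j) \<le> d"
  shows "matrix_metric \<pi> V D n \<phi> \<psi> \<le> ennreal (real n * (real n * d))"
  unfolding matrix_metric_def
proof (intro SUP_least ennreal_leI complex_matrix_norm_block_le d)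
  fix r a i j u v
  assume a: "a \<in> lipschitz_matrix_ball \<pi> V D r" and ij: "i < n" "j < n"
    and uv: "L2_set (\<lambda>k. cmod (u k)) {..<r} \<le> 1" "L2_set (\<lambda>l. cmod (v l)) {..<r} \<le> 1"
  have "(\<Sum>k<r. \<Sum>l<r. u k * v l * (pairing \<phi> a (i, k) (j, l) - pairing \<psi> a (i, k) (j, l))) =
      \<phi> (\<Sum>k<r. \<Sum>l<r. (u k * v l) *\<^sub>C a k l) i j - \<psi> (\<Sum>k<r. \<Sum>l<r. (u k * v l) *\<^sub>C a k l) i j"
    by (simp add: pairing_def matrix_state_sum[OF \<phi>] matrix_state_sum[OF \<psi>] matrix_state_scaleC[OF \<phi>]
        matrix_state_scaleC[OF \<psi>] right_diff_distrib sum_subtractf)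
  then show "cmod (\<Sum>k<r. \<Sum>l<r. u k * v l * (pairing \<phi> a (i, k) (j, l) - pairing \<psi> a (i, k) (j, l))) \<le> d"
    using le[OF compression_in_lipschitz_ball[OF a uv] ij] by simp
qed

end


section \<open>Comparison of the topologies\<close>

lemma infdist_zero_scalar_coset_less_iff:
  "infdist 0 (scalar_coset a) < e \<longleftrightarrow> (\<exists>c. norm (a + c *\<^sub>C 1) < e)"
proof -
  have "bdd_below (dist 0 ` scalar_coset a)" by (rule bdd_belowI[of _ 0]) auto
  then show ?thesis
    by (subst infdist_notempty) (auto simp: scalar_coset_def cINF_less_iff)
qed

text \<open>Centres of a net are cosets of elements of \<open>S\<close>, so they lift to
  \<open>S\<close>, and a strict bound on the distance of two cosets is realised by some scalar
  \<open>c\<close>.\<close>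

lemma mtotally_bounded_scalar_coset_iff:
  fixes S M :: "'a::unital_cstar_algebra set"
  assumes "S \<subseteq> M"
  shows "Metric_space.mtotally_bounded (scalar_coset ` M) quotient_dist (scalar_coset ` S) \<longleftrightarrow>
    (\<forall>e>0. \<exists>K. finite K \<and> K \<subseteq> S \<and> (\<forall>a\<in>S. \<exists>b\<in>K. \<exists>c. norm (a - b + c *\<^sub>C 1) < e))"
proof -
  interpret Metric_space "scalar_coset ` M" quotient_dist by (rule quotient_metric_space)
  have dist: "quotient_dist (scalar_coset b) (scalar_coset a) < e \<longleftrightarrow> (\<exists>c. norm (a - b + c *\<^sub>C 1) < e)"
    for a b :: 'a and e
    unfolding commute[of "scalar_coset b"]
    by (simp add: quotient_dist_coset quotient_norm_def infdist_zero_scalar_coset_less_iff)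
  have mball: "scalar_coset ` S \<subseteq> (\<Union>x\<in>scalar_coset ` K. mball x e) \<longleftrightarrow>
      (\<forall>a\<in>S. \<exists>b\<in>K. \<exists>c. norm (a - b + c *\<^sub>C 1) < e)" if "K \<subseteq> S" for K e
  proof -
    have *: "scalar_coset a \<in> mball (scalar_coset b) e \<longleftrightarrow> (\<exists>c. norm (a - b + c *\<^sub>C 1) < e)"
      if "a \<in> S" "b \<in> K" for a b
      using that \<open>K \<subseteq> S\<close> assms by (auto simp: in_mball dist)
    have "scalar_coset a \<in> (\<Union>x\<in>scalar_coset ` K. mball x e) \<longleftrightarrow>
        (\<exists>b\<in>K. \<exists>c. norm (a - b + c *\<^sub>C 1) < e)"
      if "a \<in> S" for a
      unfolding UN_iff bex_simps(7) by (intro bex_cong refl * that)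
    then show ?thesis unfolding image_subset_iff by (intro ball_cong refl)
  qed
  show ?thesis
    unfolding mtotally_bounded_def
  proof (intro iff_allI imp_cong refl iffI)
    fix e :: real
    assume "\<exists>K. finite K \<and> K \<subseteq> scalar_coset ` S \<and> scalar_coset ` S \<subseteq> (\<Union>x\<in>K. mball x e)"
    then obtain K' where K': "finite K'" "K' \<subseteq> scalar_coset ` S" and cover: "scalar_coset ` S \<subseteq> (\<Union>x\<in>K'. mball x e)"
      by blast
    obtain K where K: "K \<subseteq> S" "finite K" "K' = scalar_coset ` K"
      using finite_subset_image[OF K'] by blast
    have "\<forall>a\<in>S. \<exists>b\<in>K. \<exists>c. norm (a - b + c *\<^sub>C 1) < e"
      using cover unfolding K(3) mball[OF K(1)] .
    then show "\<exists>K. finite K \<and> K \<subseteq> S \<and> (\<forall>a\<in>S. \<exists>b\<in>K. \<exists>c. norm (a - b + c *\<^sub>C 1) < e)"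
      using K(1,2) by blast
  next
    fix e :: real
    assume "\<exists>K. finite K \<and> K \<subseteq> S \<and> (\<forall>a\<in>S. \<exists>b\<in>K. \<exists>c. norm (a - b + c *\<^sub>C 1) < e)"
    then obtain K where K: "finite K" "K \<subseteq> S" "\<forall>a\<in>S. \<exists>b\<in>K. \<exists>c. norm (a - b + c *\<^sub>C 1) < e" by blast
    then have "finite (scalar_coset ` K)" "scalar_coset ` K \<subseteq> scalar_coset ` S"
      "scalar_coset ` S \<subseteq> (\<Union>x\<in>scalar_coset ` K. mball x e)"
      using mball[OF K(2)] by auto
    then show "\<exists>K. finite K \<and> K \<subseteq> scalar_coset ` S \<and> scalar_coset ` S \<subseteq> (\<Union>x\<in>K. mball x e)"
      by blast
  qed
qed

text \<open>Real and imaginary parts are rounded down to a grid of mesh \<open>e/2\<close>.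
  Boundedness leaves finitely many patterns \<open>q x\<close>; one representative per pattern
  suffices, since two errors below \<open>e/2\<close> add up to less than \<open>e\<close>.\<close>

lemma finite_net_of_bounded_functions:
  fixes f :: "'i \<Rightarrow> 'x \<Rightarrow> complex"
  assumes fin: "finite I" and bdd: "\<And>i. i \<in> I \<Longrightarrow> \<exists>C. \<forall>x\<in>L. cmod (f i x) \<le> C" and e: "e > 0"
  shows "\<exists>K. finite K \<and> K \<subseteq> L \<and> (\<forall>x\<in>L. \<exists>y\<in>K. \<forall>i\<in>I. cmod (f i x - f i y) < e)"
proof -
  obtain C where C: "\<And>i x. i \<in> I \<Longrightarrow> x \<in> L \<Longrightarrow> cmod (f i x) \<le> C i" using bdd by metis
  define N where "N i = {\<lfloor>- C i / (e/2)\<rfloor>..\<lfloor>C i / (e/2)\<rfloor>}" for i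
  define q where "q x = (\<lambda>i\<in>I. (\<lfloor>Re (f i x) / (e/2)\<rfloor>, \<lfloor>Im (f i x) / (e/2)\<rfloor>))" for x
  have "q x \<in> Pi\<^sub>E I (\<lambda>i. N i \<times> N i)" if x: "x \<in> L" for x
  proof -
    have "\<lfloor>r / (e/2)\<rfloor> \<in> N i" if "i \<in> I" "\<bar>r\<bar> \<le> cmod (f i x)" for r i
    proof -
      have "- C i \<le> r" "r \<le> C i" using C[OF that(1) x] that(2) by linarith+
      then show ?thesis unfolding N_def atLeastAtMost_iff using e
        by (intro conjI floor_mono divide_right_mono) auto
    qed
    then show ?thesis unfolding q_def using abs_Re_le_cmod abs_Im_le_cmod by (intro restrict_PiE_iff[THEN iffD2]) auto
  qed
  then have "finite (q ` L)"
    by (intro finite_subset[OF image_subsetI finite_PiE[OF fin, of "\<lambda>i. N i \<times> N i"]]) (auto simp: N_def)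
  then have "finite (inv_into L q ` q ` L)" by simp
  moreover have "inv_into L q ` q ` L \<subseteq> L" by (auto intro: inv_into_into)
  moreover have "\<exists>y\<in>inv_into L q ` q ` L. \<forall>i\<in>I. cmod (f i x - f i y) < e" if x: "x \<in> L" for x
  proof (intro bexI ballI)
    let ?y = "inv_into L q (q x)"
    fix i assume i: "i \<in> I"
    have "q ?y i = q x i" using x by (simp add: f_inv_into_f)
    then have fl: "\<lfloor>Re (f i x) / (e/2)\<rfloor> = \<lfloor>Re (f i ?y) / (e/2)\<rfloor>"
      "\<lfloor>Im (f i x) / (e/2)\<rfloor> = \<lfloor>Im (f i ?y) / (e/2)\<rfloor>"
      using i by (simp_all add: q_def)
    have close: "\<bar>s - t\<bar> < e/2" if "\<lfloor>s / (e/2)\<rfloor> = \<lfloor>t / (e/2)\<rfloor>" for s t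
    proof -
      have "\<bar>s / (e/2) - t / (e/2)\<bar> < 1" using that by linarith
      then have "\<bar>s - t\<bar> / (e/2) < 1"
        using e unfolding diff_divide_distrib[symmetric] abs_divide by simp
      then show ?thesis using e by (simp add: pos_divide_less_eq)
    qed
    have "cmod (f i x - f i ?y) \<le> \<bar>Re (f i x - f i ?y)\<bar> + \<bar>Im (f i x - f i ?y)\<bar>" by (rule cmod_le)
    then show "cmod (f i x - f i ?y) < e" using close[OF fl(1)] close[OF fl(2)] by simp
  qed (use x in blast)
  ultimately show ?thesis by blast
qed

text \<open>By Tychonoff's theorem the product of the discs of radius \<open>2 * norm a\<close> is
  compact, and the states form a closed subset of it.\<close>

lemma compact_cstar_states: "compact {g :: 'a::unital_cstar_algebra \<Rightarrow> complex. cstar_state g}"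
proof -
  have "closed {g :: 'a \<Rightarrow> complex. cstar_state g}"
    unfolding cstar_state_def
    by (intro closed_Collect_conj closed_Collect_all closed_Collect_eq closed_Collect_le continuous_intros
        continuous_on_product_coordinates)
  moreover have "compact (Pi\<^sub>E UNIV (\<lambda>a::'a. cball (0::complex) (2 * norm a)))"
  proof -
    have "compactin (product_topology (\<lambda>_. euclidean) UNIV) (Pi\<^sub>E UNIV (\<lambda>a::'a. cball (0::complex) (2 * norm a)))"
      unfolding compactin_PiE by simp
    then show ?thesis unfolding euclidean_product_topology by simp
  qed
  moreover have "{g. cstar_state g} = Pi\<^sub>E UNIV (\<lambda>a::'a. cball 0 (2 * norm a)) \<inter> {g. cstar_state g}"
    by (auto simp: cstar_state_bound)
  ultimately show ?thesis by (metis compact_Int_closed)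
qed

lemma continuous_on_eval: "continuous_on UNIV (\<lambda>\<phi> :: 'a \<Rightarrow> 'b \<Rightarrow> 'c \<Rightarrow> 'd::topological_space. \<phi> a i j)"
proof -
  have "continuous_on UNIV (\<lambda>\<phi> :: 'a \<Rightarrow> 'b \<Rightarrow> 'c \<Rightarrow> 'd. \<phi> a)" by simp
  then have "continuous_on UNIV (\<lambda>\<phi> :: 'a \<Rightarrow> 'b \<Rightarrow> 'c \<Rightarrow> 'd. \<phi> a i)"
    by (rule continuous_on_product_then_coordinatewise)
  then show ?thesis by (rule continuous_on_product_then_coordinatewise)
qed

lemma cstar_state_convex_combination:
  assumes "cstar_state g" "cstar_state h" "0 \<le> t" "t \<le> 1"
  shows "cstar_state (\<lambda>a. (1 - complex_of_real t) * g a + complex_of_real t * h a)"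
  unfolding cstar_state_def
proof (intro conjI allI)
  fix b
  have "0 \<le> (1 - t) * Re (g (star b * b)) + t * Re (h (star b * b))"
    using assms by (intro add_nonneg_nonneg mult_nonneg_nonneg) (auto simp: cstar_state_def)
  then show "0 \<le> Re ((1 - complex_of_real t) * g (star b * b) + complex_of_real t * h (star b * b))"
    by simp
qed (use assms in \<open>simp_all add: cstar_state_def algebra_simps\<close>)

section \<open>Inclusions between the two topologies\<close>

context fredholm_module
begin

lemma openin_DL:
  "openin (DL_topology \<pi> V D n) U \<longleftrightarrow> metric_open (matrix_states n) (matrix_metric \<pi> V D n) U"
  by (simp add: DL_topology_def istopology_metric_open)

lemma topspace_DL: "topspace (DL_topology \<pi> V D n) = matrix_states n"
proof -
  have "metric_open (matrix_states n) (matrix_metric \<pi> V D n) (matrix_states n)"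
    unfolding metric_open_def by (auto intro: exI[of _ 1])
  then show ?thesis unfolding topspace_def openin_DL by (auto simp: metric_open_def)
qed

lemma continuous_map_DL_eval: "continuous_map (DL_topology \<pi> V D n) euclidean (\<lambda>\<phi>. \<phi> a i j)"
  unfolding continuous_map_def topspace_DL openin_DL metric_open_def
proof (intro conjI allI impI ballI)
  fix W \<phi>
  assume W: "openin euclidean W" and "\<phi> \<in> {\<phi> \<in> matrix_states n. \<phi> a i j \<in> W}"
  then have \<phi>: "\<phi> \<in> matrix_states n" "\<phi> a i j \<in> W" by auto
  obtain e where e: "e > 0" "\<And>z. dist z (\<phi> a i j) < e \<Longrightarrow> z \<in> W"
    using W \<phi>(2) by (auto simp: open_dist)
  \<comment> \<open>Replacing \<open>a\<close> by \<open>b\<close> costs at most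
    \<open>e / 4\<close> in each of the two states, by \<open>matrix_state_bound\<close>; the metric
    accounts for the remaining \<open>e / 2\<close>, once \<open>b\<close> is scaled into the
    ball.\<close>
  obtain b where b: "b \<in> lip" "dist b a < e / 8"
    using dense_lip e(1) closure_approachable[of a lip] by (metis UNIV_I divide_pos_pos zero_less_numeral)
  obtain t where t: "t > 0" "complex_of_real t *\<^sub>C b \<in> lball" by (rule scaled_in_lipschitz_ball[OF b(1)])
  show "\<exists>e>0. \<forall>\<psi>\<in>matrix_states n. matrix_metric \<pi> V D n \<phi> \<psi> < e \<longrightarrow>
      \<psi> \<in> {\<phi> \<in> matrix_states n. \<phi> a i j \<in> W}"
  proof (intro exI[of _ "ennreal (t * (e / 2))"] conjI ballI impI)
    show "0 < ennreal (t * (e / 2))" using t e by simp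
    fix \<psi> assume \<psi>: "\<psi> \<in> matrix_states n" and less: "matrix_metric \<pi> V D n \<phi> \<psi> < ennreal (t * (e / 2))"
    have "dist (\<psi> a i j) (\<phi> a i j) < e"
    proof (cases "i < n \<and> j < n")
      case False
      then show ?thesis using e matrix_state_outside[OF \<phi>(1)] matrix_state_outside[OF \<psi>] by simp
    next
      case True
      have "ennreal (cmod (\<phi> (complex_of_real t *\<^sub>C b) i j - \<psi> (complex_of_real t *\<^sub>C b) i j)) < ennreal (t * (e / 2))"
        using matrix_metric_ge[OF t(2)] True less by (meson order_le_less_trans)
      then have "cmod (complex_of_real t * (\<phi> b i j - \<psi> b i j)) < t * (e / 2)"
        using t e by (simp add: ennreal_less_iff matrix_state_scaleC[OF \<phi>(1)] matrix_state_scaleC[OF \<psi>] right_diff_distrib)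
      then have *: "cmod (\<phi> b i j - \<psi> b i j) < e / 2" using t by (simp add: norm_mult)
      have "cmod (\<phi> (a - b) i j) \<le> e / 4" "cmod (\<psi> (a - b) i j) \<le> e / 4"
        using matrix_state_bound[OF \<phi>(1), of "a - b" i j] matrix_state_bound[OF \<psi>, of "a - b" i j] b(2)
        by (simp_all add: dist_norm norm_minus_commute)
      moreover have "\<psi> a i j - \<phi> a i j = \<psi> (a - b) i j - \<phi> (a - b) i j - (\<phi> b i j - \<psi> b i j)"
        by (simp add: matrix_state_diff[OF \<phi>(1)] matrix_state_diff[OF \<psi>])
      then have "cmod (\<psi> a i j - \<phi> a i j) \<le> cmod (\<psi> (a - b) i j) + cmod (\<phi> (a - b) i j) + cmod (\<phi> b i j - \<psi> b i j)"
        using norm_triangle_ineq4[of "\<psi> (a - b) i j - \<phi> (a - b) i j" "\<phi> b i j - \<psi> b i j"]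
          norm_triangle_ineq4[of "\<psi> (a - b) i j" "\<phi> (a - b) i j"] by simp
      ultimately show ?thesis using * by (simp add: dist_norm)
    qed
    then show "\<psi> \<in> {\<phi> \<in> matrix_states n. \<phi> a i j \<in> W}" using \<psi> e by simp
  qed
qed auto

text \<open>The Euclidean topology is an iterated product topology, so continuity of the identity
  reduces to that of the evaluations \<open>\<phi> a i j\<close>.\<close>

lemma openin_BW_imp_openin_DL:
  assumes "openin (BW_topology n) U"
  shows "openin (DL_topology \<pi> V D n) U"
proof -
  have "continuous_map (DL_topology \<pi> V D n) (product_topology (\<lambda>_. product_topology (\<lambda>_. product_topology
      (\<lambda>_. euclidean) UNIV) UNIV) UNIV) (\<lambda>\<phi>. \<phi>)"
    unfolding continuous_map_componentwise_UNIV using continuous_map_DL_eval by blast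
  then have cont: "continuous_map (DL_topology \<pi> V D n) euclidean (\<lambda>\<phi>. \<phi>)"
    unfolding euclidean_product_topology .
  obtain T where T: "open T" "U = T \<inter> matrix_states n"
    using assms by (auto simp: BW_topology_def openin_subtopology)
  have "openin (DL_topology \<pi> V D n) {\<phi> \<in> topspace (DL_topology \<pi> V D n). \<phi> \<in> T}"
    using openin_continuous_map_preimage[OF cont] T(1) by simp
  moreover have "{\<phi> \<in> topspace (DL_topology \<pi> V D n). \<phi> \<in> T} = U"
    using T(2) by (auto simp: topspace_DL)
  ultimately show ?thesis by simp
qed

lemma openin_DL_imp_openin_BW:
  assumes net: "\<And>e. e > 0 \<Longrightarrow>
      \<exists>K. finite K \<and> K \<subseteq> lball \<and> (\<forall>a\<in>lball. \<exists>b\<in>K. \<exists>c. norm (a - b + c *\<^sub>C 1) < e)"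
    and U: "openin (DL_topology \<pi> V D n) U"
  shows "openin (BW_topology n) U"
proof (subst openin_subopen, rule ballI)
  fix \<phi> assume "\<phi> \<in> U"
  then obtain e where U_sub: "U \<subseteq> matrix_states n" and e: "e > 0"
    "\<And>\<psi>. \<psi> \<in> matrix_states n \<Longrightarrow> matrix_metric \<pi> V D n \<phi> \<psi> < e \<Longrightarrow> \<psi> \<in> U"
    using U unfolding openin_DL metric_open_def by blast
  have \<phi>: "\<phi> \<in> matrix_states n" using \<open>\<phi> \<in> U\<close> U_sub by blast
  \<comment> \<open>The radius \<open>e\<close> may be infinite; a smaller \<open>x\<close> is
    finite and leaves room for a bound that is not strict.\<close>
  obtain x where x: "0 < x" "x < e" using dense[OF e(1)] by blast
  have "x < top" using x(2) top_greatest by (rule order_less_le_trans)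
  then obtain s where "s \<ge> 0" and sx: "ennreal s = x" by (cases x) auto
  then have s: "s > 0" using x(1) by auto
  \<comment> \<open>Chosen so that \<open>n\<^sup>2 * d \<le> s\<close>; the summand 1 covers
    \<open>n = 0\<close>.\<close>
  define d where "d = s / (real n * real n + 1)"
  have pos: "real n * real n + 1 > 0" by (simp add: add_nonneg_pos)
  have d: "d > 0" using s pos by (simp add: d_def)
  have "real n * real n * s \<le> s * (real n * real n + 1)" using s by (simp add: algebra_simps)
  then have nd: "real n * (real n * d) \<le> s" using pos by (simp add: d_def pos_divide_le_eq)
  \<comment> \<open>A remainder of norm below \<open>d / 8\<close> contributes at most
    \<open>d / 4\<close> for each of the two maps, which leaves \<open>d / 2\<close> for the net
    point.\<close>
  obtain K where K: "finite K" "K \<subseteq> lball"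
    "\<And>a. a \<in> lball \<Longrightarrow> \<exists>b\<in>K. \<exists>c. norm (a - b + c *\<^sub>C 1) < d / 8"
    using net[of "d / 8"] d by auto
  define T where "T = (\<Inter>b\<in>K. \<Inter>i\<in>{..<n}. \<Inter>j\<in>{..<n}. {\<psi>. cmod (\<phi> b i j - \<psi> b i j) < d / 2})"
  have "open T"
    unfolding T_def using K(1)
    by (intro open_INT ballI open_Collect_less continuous_intros continuous_on_eval) auto
  then have "openin (BW_topology n) (T \<inter> matrix_states n)"
    by (auto simp: BW_topology_def openin_subtopology)
  moreover have "\<phi> \<in> T \<inter> matrix_states n" using \<phi> d by (simp add: T_def)
  moreover have "T \<inter> matrix_states n \<subseteq> U"
  proof
    fix \<psi> assume "\<psi> \<in> T \<inter> matrix_states n"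
    then have \<psi>: "\<psi> \<in> matrix_states n"
      and T: "\<And>b i j. b \<in> K \<Longrightarrow> i < n \<Longrightarrow> j < n \<Longrightarrow> cmod (\<phi> b i j - \<psi> b i j) < d / 2"
      by (auto simp: T_def)
    have "matrix_metric \<pi> V D n \<phi> \<psi> \<le> ennreal (real n * (real n * d))"
    proof (rule matrix_metric_le[OF \<phi> \<psi>])
      fix a i j assume a: "a \<in> lball" and ij: "i < n" "j < n"
      obtain b c where b: "b \<in> K" and c: "norm (a - b + c *\<^sub>C 1) < d / 8" using K(3)[OF a] by blast
      let ?x = "a - b + c *\<^sub>C 1"
      \<comment> \<open>Both maps are unital, so the contributions of \<open>c *\<^sub>C 1\<close>
        cancel.\<close>
      have eq: "\<phi> a i j - \<psi> a i j = (\<phi> b i j - \<psi> b i j) + (\<phi> ?x i j - \<psi> ?x i j)"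
        using ij by (simp add: matrix_state_add[OF \<phi>] matrix_state_diff[OF \<phi>] matrix_state_scaleC[OF \<phi>]
            matrix_state_one[OF \<phi>] matrix_state_add[OF \<psi>] matrix_state_diff[OF \<psi>]
            matrix_state_scaleC[OF \<psi>] matrix_state_one[OF \<psi>])
      have "cmod (\<phi> a i j - \<psi> a i j) \<le> cmod (\<phi> b i j - \<psi> b i j) + (cmod (\<phi> ?x i j) + cmod (\<psi> ?x i j))"
        unfolding eq
        using norm_triangle_ineq[of "\<phi> b i j - \<psi> b i j" "\<phi> ?x i j - \<psi> ?x i j"]
          norm_triangle_ineq4[of "\<phi> ?x i j" "\<psi> ?x i j"] by linarith
      then show "cmod (\<phi> a i j - \<psi> a i j) \<le> d"
        using T[OF b ij] matrix_state_bound[OF \<phi>, of ?x i j] matrix_state_bound[OF \<psi>, of ?x i j] c by linarith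
    qed (use d in simp)
    also have "\<dots> \<le> ennreal s" using nd by (rule ennreal_leI)
    finally show "\<psi> \<in> U" using e(2)[OF \<psi>] sx x(2) by (metis order_le_less_trans)
  qed
  ultimately show "\<exists>T. openin (BW_topology n) T \<and> \<phi> \<in> T \<and> T \<subseteq> U" by blast
qed

section \<open>From equal topologies at size 1 to a finite net\<close>

lemma state_neighbourhood:
  assumes top: "DL_topology \<pi> V D 1 = BW_topology 1" and g: "cstar_state g" and e: "e > 0"
  shows "\<exists>W. open W \<and> g \<in> W \<and> (\<forall>h\<in>W. cstar_state h \<longrightarrow> (\<forall>a\<in>lball. cmod (g a - h a) \<le> e))"
proof -
  define emb :: "('a \<Rightarrow> complex) \<Rightarrow> 'a \<Rightarrow> nat \<Rightarrow> nat \<Rightarrow> complex"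
    where "emb h = (\<lambda>a i j. if i = 0 \<and> j = 0 then h a else 0)" for h
  have emb: "emb h \<in> matrix_states 1" if "cstar_state h" for h
    unfolding emb_def using cstar_state_in_matrix_states[OF that] .
  \<comment> \<open>A uniform bound \<open>e'\<close> strictly below \<open>e\<close> leaves the
    margin \<open>e - e'\<close> that makes \<open>U\<close> open for the metric.\<close>
  define U where "U = {\<psi> \<in> matrix_states 1. \<exists>e'<e. \<forall>a\<in>lball. cmod (g a - \<psi> a 0 0) \<le> e'}"
  have "metric_open (matrix_states 1) (matrix_metric \<pi> V D 1) U"
    unfolding metric_open_def
  proof (intro conjI ballI)
    fix \<psi> assume "\<psi> \<in> U"
    then obtain e' where e': "e' < e" "\<And>a. a \<in> lball \<Longrightarrow> cmod (g a - \<psi> a 0 0) \<le> e'" by (auto simp: U_def)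
    show "\<exists>e>0. \<forall>\<omega>\<in>matrix_states 1. matrix_metric \<pi> V D 1 \<psi> \<omega> < e \<longrightarrow> \<omega> \<in> U"
    proof (intro exI[of _ "ennreal ((e - e') / 2)"] conjI ballI impI)
      show "0 < ennreal ((e - e') / 2)" using e' by simp
      fix \<omega> assume \<omega>: "\<omega> \<in> matrix_states 1" and less: "matrix_metric \<pi> V D 1 \<psi> \<omega> < ennreal ((e - e') / 2)"
      have "cmod (g a - \<omega> a 0 0) \<le> e' + (e - e') / 2" if a: "a \<in> lball" for a
      proof -
        have "ennreal (cmod (\<psi> a 0 0 - \<omega> a 0 0)) < ennreal ((e - e') / 2)"
          using matrix_metric_ge[OF a, of 0 1 0 \<psi> \<omega>] less by simp
        then have "cmod (\<psi> a 0 0 - \<omega> a 0 0) < (e - e') / 2" by (simp add: ennreal_less_iff)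
        moreover have "dist (g a) (\<omega> a 0 0) \<le> dist (g a) (\<psi> a 0 0) + dist (\<psi> a 0 0) (\<omega> a 0 0)"
          by (rule dist_triangle)
        ultimately show ?thesis using e'(2)[OF a] unfolding dist_norm by linarith
      qed
      moreover have "e' + (e - e') / 2 < e" using e'(1) by (simp add: field_simps)
      ultimately show "\<omega> \<in> U" using \<omega> by (auto simp: U_def)
    qed
  qed (auto simp: U_def)
  then have "openin (BW_topology 1) U" unfolding top[symmetric] openin_DL .
  then obtain T where T: "open T" "U = T \<inter> matrix_states 1"
    by (auto simp: BW_topology_def openin_subtopology)
  have "continuous_on UNIV (\<lambda>h. if i = 0 \<and> j = 0 then h a else 0)" for a :: 'a and i j :: nat
    by (cases "i = 0"; cases "j = 0"; simp)
  then have "continuous_on UNIV emb"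
    unfolding emb_def by (intro continuous_on_coordinatewise_then_product)
  then have "open (emb -` T)" using T(1) by (rule open_vimage[rotated])
  moreover have "emb g \<in> U"
    using emb[OF g] e by (auto simp: U_def emb_def intro!: exI[of _ 0])
  then have "g \<in> emb -` T" using T(2) by auto
  moreover have "cmod (g a - h a) \<le> e" if "h \<in> emb -` T" "cstar_state h" "a \<in> lball" for h a
  proof -
    have "emb h \<in> U" using that emb T(2) by auto
    then show ?thesis using that(3) by (fastforce simp: U_def emb_def)
  qed
  ultimately show ?thesis by blast
qed

text \<open>The functional seminorm attached to the Lipschitz ball is homogeneous along the segment from \<open>g\<close>
  to \<open>h\<close>, and at most 1 near \<open>g\<close>.\<close>

lemma states_bounded_on_lipschitz_ball:
  assumes top: "DL_topology \<pi> V D 1 = BW_topology 1" and g: "cstar_state g" and h: "cstar_state h"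
  shows "\<exists>C. \<forall>a\<in>lball. cmod (g a - h a) \<le> C"
proof -
  obtain W where W: "open W" "g \<in> W"
    "\<And>k a. k \<in> W \<Longrightarrow> cstar_state k \<Longrightarrow> a \<in> lball \<Longrightarrow> cmod (g a - k a) \<le> 1"
    using state_neighbourhood[OF top g, of 1] by auto
  define \<gamma> where "\<gamma> t = (\<lambda>a. (1 - complex_of_real t) * g a + complex_of_real t * h a)" for t
  have "continuous_on UNIV \<gamma>"
    unfolding \<gamma>_def by (intro continuous_on_coordinatewise_then_product continuous_intros)
  then have "open (\<gamma> -` W)" using W(1) by (rule open_vimage[rotated])
  moreover have "0 \<in> \<gamma> -` W" using W(2) by (simp add: \<gamma>_def)
  ultimately have "\<exists>r>0. \<forall>t. dist t 0 < r \<longrightarrow> t \<in> \<gamma> -` W" unfolding open_dist by blast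
  then obtain r where r: "r > 0" "\<And>t. dist t 0 < r \<Longrightarrow> \<gamma> t \<in> W" by (metis vimageD)
  \<comment> \<open>Small enough for \<open>\<gamma> t\<close> to lie in \<open>W\<close>, and at
    most 1 so that it remains a state.\<close>
  define t where "t = min (r / 2) 1"
  have t: "0 < t" "t \<le> 1" "\<gamma> t \<in> W" using r by (auto simp: t_def)
  have "cstar_state (\<gamma> t)" unfolding \<gamma>_def using t by (intro cstar_state_convex_combination g h) auto
  then have "cmod (g a - \<gamma> t a) \<le> 1" if "a \<in> lball" for a using W(3) t that by blast
  moreover have "g a - \<gamma> t a = complex_of_real t * (g a - h a)" for a by (simp add: \<gamma>_def algebra_simps)
  ultimately have "t * cmod (g a - h a) \<le> 1" if "a \<in> lball" for a
    using that t(1) by (metis norm_mult norm_of_real abs_of_pos)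
  then have "cmod (g a - h a) \<le> 1 / t" if "a \<in> lball" for a
    using that t(1) by (simp add: field_simps)
  then show ?thesis by blast
qed

lemma lipschitz_ball_finite_net:
  assumes top: "DL_topology \<pi> V D 1 = BW_topology 1" and e: "e > 0"
  shows "\<exists>K. finite K \<and> K \<subseteq> lball \<and> (\<forall>a\<in>lball. \<exists>b\<in>K. \<exists>c. norm (a - b + c *\<^sub>C 1) < e)"
proof -
  \<comment> \<open>Three errors of size \<open>d\<close> occur in each state and
    \<open>norm_le_states\<close> costs a factor 6, so the total is
    \<open>18 * d < e\<close>.\<close>
  define d where "d = e / 20"
  have d: "d > 0" using e by (simp add: d_def)
  obtain W where W: "\<And>g. cstar_state g \<Longrightarrow> open (W g)" "\<And>g. cstar_state g \<Longrightarrow> g \<in> W g"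
    "\<And>g h a. cstar_state g \<Longrightarrow> h \<in> W g \<Longrightarrow> cstar_state h \<Longrightarrow> a \<in> lball \<Longrightarrow> cmod (g a - h a) \<le> d"
    using state_neighbourhood[OF top _ d] by metis
  have "open (W g)" if "g \<in> {g. cstar_state g}" for g using that W(1) by simp
  moreover have "{g. cstar_state g} \<subseteq> (\<Union>g\<in>{g. cstar_state g}. W g)" using W(2) by blast
  ultimately obtain G where G: "G \<subseteq> {g. cstar_state g}" "finite G" "{g. cstar_state g} \<subseteq> (\<Union>g\<in>G. W g)"
    by (rule compactE_image[OF compact_cstar_states])
  obtain g\<^sub>0 :: "'a \<Rightarrow> complex" where g\<^sub>0: "cstar_state g\<^sub>0" using cstar_state_exists[of 0] by auto
  \<comment> \<open>A single state need not be bounded on the ball, but its difference from the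
    fixed state is.\<close>
  have bdd: "\<exists>C. \<forall>a\<in>lball. cmod (g a - g\<^sub>0 a) \<le> C" if "g \<in> G" for g
    using states_bounded_on_lipschitz_ball[OF top _ g\<^sub>0] G(1) that by blast
  have "\<exists>K. finite K \<and> K \<subseteq> lball \<and>
      (\<forall>a\<in>lball. \<exists>b\<in>K. \<forall>g\<in>G. cmod ((g a - g\<^sub>0 a) - (g b - g\<^sub>0 b)) < d)"
    by (rule finite_net_of_bounded_functions[where I = G and f = "\<lambda>g a. g a - g\<^sub>0 a", OF G(2) bdd d])
  then obtain K where K: "finite K" "K \<subseteq> lball"
    and net: "\<forall>a\<in>lball. \<exists>b\<in>K. \<forall>g\<in>G. cmod ((g a - g\<^sub>0 a) - (g b - g\<^sub>0 b)) < d" by blast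
  have "\<exists>b\<in>K. \<exists>c. norm (a - b + c *\<^sub>C 1) < e" if a: "a \<in> lball" for a
  proof -
    obtain b where b: "b \<in> K" "\<And>g. g \<in> G \<Longrightarrow> cmod ((g a - g\<^sub>0 a) - (g b - g\<^sub>0 b)) < d"
      using net a by blast
    \<comment> \<open>With this scalar the fixed state vanishes at
      \<open>a - b + c *\<^sub>C 1\<close>.\<close>
    define c where "c = - (g\<^sub>0 a - g\<^sub>0 b)"
    have "cmod (h (a - b + c *\<^sub>C 1)) \<le> 3 * d" if h: "cstar_state h" for h
    proof -
      obtain g where g: "g \<in> G" "h \<in> W g" using G(3) h by blast
      have sg: "cstar_state g" using G(1) g by blast
      have "h (a - b + c *\<^sub>C 1) = h a - h b + c"
      proof -
        have add: "h (x + y) = h x + h y" and "h (c *\<^sub>C 1) = c" for x y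
          using h unfolding cstar_state_def by simp_all
        then show ?thesis using add[of "a - b" b] by simp
      qed
      also have "\<dots> = ((g a - g\<^sub>0 a) - (g b - g\<^sub>0 b)) - (g a - h a) + (g b - h b)" by (simp add: c_def)
      also have "cmod \<dots> \<le> cmod ((g a - g\<^sub>0 a) - (g b - g\<^sub>0 b)) + cmod (g a - h a) + cmod (g b - h b)"
        by (intro order_trans[OF norm_triangle_ineq] add_right_mono norm_triangle_ineq4)
      also have "\<dots> \<le> d + d + d"
        using b K(2) a g h sg W(3) by (intro add_mono less_imp_le[OF b(2)]) auto
      finally show ?thesis by simp
    qed
    then have "norm (a - b + c *\<^sub>C 1) \<le> 6 * (3 * d)" by (rule norm_le_states)
    then have "norm (a - b + c *\<^sub>C 1) < e" using e by (simp add: d_def)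
    then show ?thesis using b(1) by blast
  qed
  then show ?thesis using K(1,2) by blast
qed

end

theorem theorem4p3:
  fixes \<pi> :: "'a::unital_cstar_algebra \<Rightarrow> 'h::complex_hilbert_space \<Rightarrow> 'h"
    and V :: "'h set" and D :: "'h \<Rightarrow> 'h"
  assumes "unbounded_fredholm_module \<pi> V D"
    and "commutator_linear \<pi> V D"
  shows "(\<forall>n\<ge>1. DL_topology \<pi> V D n = BW_topology n) \<longleftrightarrow>
    Metric_space.mtotally_bounded (scalar_coset ` lipschitz_elements \<pi> V D) quotient_dist
      (scalar_coset ` lipschitz_ball \<pi> V D)"
proof -
  interpret fredholm_module \<pi> V D using assms by unfold_locales
  have "lball \<subseteq> lip" by (auto simp: lipschitz_ball_def)
  note totally_bounded = mtotally_bounded_scalar_coset_iff[OF this]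
  show ?thesis
    unfolding totally_bounded
  proof
    assume "\<forall>n\<ge>1. DL_topology \<pi> V D n = BW_topology n"
    then show "\<forall>e>0. \<exists>K. finite K \<and> K \<subseteq> lball \<and> (\<forall>a\<in>lball. \<exists>b\<in>K. \<exists>c. norm (a - b + c *\<^sub>C 1) < e)"
      using lipschitz_ball_finite_net by blast
  next
    assume "\<forall>e>0. \<exists>K. finite K \<and> K \<subseteq> lball \<and> (\<forall>a\<in>lball. \<exists>b\<in>K. \<exists>c. norm (a - b + c *\<^sub>C 1) < e)"
    then show "\<forall>n\<ge>1. DL_topology \<pi> V D n = BW_topology n"
      using openin_DL_imp_openin_BW openin_BW_imp_openin_DL by (auto simp: topology_eq)
  qed
qed

end
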